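(* For all integers $k\ge 2$ and $r\ge 1$, we have in $\mathbb{R}[T]$ $$\sum_{i=0}^{r-1}\zeta^{\star}_{\mathrm{sh}}(\{1\}^i,k,\{1\}^{r-1-i};T)=\sum_{j=0}^{r-1}\zeta(k+r-1-j)\,\frac{T^{j}}{j!},$$ where $\{1\}^i$ means $i$ repetitions of $1$.
   Context: An index is a finite sequence $\mathbf{k}=(k_1,\ldots,k_r)$ of positive integers. For $k_r>1$ the multiple zeta value is $\zeta(k_1,\ldots,k_r)=\sum_{0<m_1<\cdots<m_r}\frac{1}{m_1^{k_1}\cdots m_r^{k_r}}$ and the multiple zeta-star value is $\zeta^{\star}(k_1,\ldots,k_r)=\sum_{0<m_1\le\cdots\le m_r}\frac{1}{m_1^{k_1}\cdots m_r^{k_r}}$; in particular $\zeta(k)$ for an integer $k>1$ is the Riemann zeta value. Shuffle-regularized polynomials $\zeta^{\star}_{\mathrm{sh}}(\mathbf{k};T)\in\mathbb{R}[T]$ (Kaneko–Yamamoto). Let $\mathbb{Q}\langle e_0,e_1\rangle$ be the noncommutative polynomial algebra equipped with the shuffle product, and let $\mathfrak{h}^1=\mathbb{Q}+e_1\mathbb{Q}\langle e_0,e_1\rangle\supset\mathfrak{h}^0=\mathbb{Q}+e_1\mathbb{Q}\langle e_0,e_1\rangle e_0$, which are shuffle subalgebras; $\mathfrak{h}^1$ is a polynomial algebra in $e_1$ over $\mathfrak{h}^0$ for the shuffle product. The $\mathbb{Q}$-linear map $Z:\mathfrak{h}^0\to\mathbb{R}$ with $Z(1)=1$ and $Z(e_1e_0^{k_1-1}\cdots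 e_1e_0^{k_r-1})=\zeta(k_1,\ldots,k_r)$ (for $k_r>1$) is a shuffle homomorphism (by the iterated integral expression with $e_1\leftrightarrow dt/(1-t)$, $e_0\leftrightarrow dt/t$, letters read from the smallest to the largest variable). Let $Z_{\mathrm{sh}}:\mathfrak{h}^1\to\mathbb{R}[T]$ be the unique shuffle homomorphism extending $Z$ with $Z_{\mathrm{sh}}(e_1)=T$. For an index $\mathbf{k}=(k_1,\ldots,k_r)$ let $X_{\mathbf{k}}$ be the finite poset with elements $x_{i,j}$ ($1\le i\le r$, $1\le j\le k_i$) whose order is generated by $x_{i,1}<x_{i,2}<\cdots<x_{i,k_i}$ for each $i$, and $x_{i,1}<x_{i+1,k_{i+1}}$ for $1\le i<r$; label $x_{i,1}$ by $e_1$ and $x_{i,j}$ ($j\ge2$) by $e_0$. Let $w_{\mathbf{k}}\in\mathfrak{h}^1$ be the sum over all linear extensions of $X_{\mathbf{k}}$ of the word obtained by reading the labels from the smallest to the largest element. Then $\zeta^{\star}_{\mathrm{sh}}(\mathbf{k};T):=Z_{\mathrm{sh}}(w_{\mathbf{k}})$. It equals $\zeta^{\star}(\mathbf{k})$ when $k_r>1$. *)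

theory Defs
  imports "HOL-Analysis.Analysis" "HOL-Library.Poly_Mapping" "HOL-Library.Multiset"
    "HOL-Computational_Algebra.Polynomial"
begin

(* An index is a list of positive integers.  The summation range for [] is {[]}, so mzv [] = 1. *)

definition mzv :: "nat list \<Rightarrow> real" where
  "mzv ks = (\<Sum>\<^sub>\<infinity>m\<in>{m :: nat list. length m = length ks \<and> (\<forall>x\<in>set m. 0 < x) \<and> sorted_wrt (<) m}.
     1 / (\<Prod>i<length ks. real (m ! i) ^ (ks ! i)))"

datatype letter = E0 | E1

(* The rational vector space underlying Q<e0,e1>: finitely supported functions on words.  Only the
   shuffle product is used on it, so the concatenation product is not set up. *)

type_synonym ncpoly = "letter list \<Rightarrow>\<^sub>0 rat"

abbreviation of_word :: "letter list \<Rightarrow> ncpoly" where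
  "of_word w \<equiv> Poly_Mapping.single w 1"

definition ncscale :: "rat \<Rightarrow> ncpoly \<Rightarrow> ncpoly" where
  "ncscale c f = Poly_Mapping.map (\<lambda>x. c * x) f"

(* All shuffles of two words, counted with multiplicity (unlike the set List.shuffles). *)

fun shuffle_words :: "'a list \<Rightarrow> 'a list \<Rightarrow> 'a list multiset" where
  "shuffle_words [] v = {#v#}"
| "shuffle_words u [] = {#u#}"
| "shuffle_words (a # u) (b # v) =
     image_mset ((#) a) (shuffle_words u (b # v)) + image_mset ((#) b) (shuffle_words (a # u) v)"

definition shuffle_prod :: "ncpoly \<Rightarrow> ncpoly \<Rightarrow> ncpoly" where
  "shuffle_prod f g =
     (\<Sum>u\<in>Poly_Mapping.keys f. \<Sum>v\<in>Poly_Mapping.keys g. \<Sum>w\<in>#shuffle_words u v.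
        Poly_Mapping.single w (Poly_Mapping.lookup f u * Poly_Mapping.lookup g v))"

definition h1 :: "ncpoly set" where
  "h1 = {f. \<forall>w\<in>Poly_Mapping.keys f. w = [] \<or> hd w = E1}"

definition h0 :: "ncpoly set" where
  "h0 = {f. \<forall>w\<in>Poly_Mapping.keys f. w = [] \<or> (hd w = E1 \<and> last w = E0)}"

definition index_word :: "nat list \<Rightarrow> letter list" where
  "index_word ks = concat (map (\<lambda>k. E1 # replicate (k - 1) E0) ks)"

definition word_index :: "letter list \<Rightarrow> nat list" where
  "word_index = inv_into {ks. 0 \<notin> set ks} index_word"

definition Z :: "ncpoly \<Rightarrow> real" where
  "Z f = (\<Sum>w\<in>Poly_Mapping.keys f. of_rat (Poly_Mapping.lookup f w) * mzv (word_index w))"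

(* The unit condition on the homomorphism is contained in the extension condition, as Z 1 = 1.
   Membership in extensional h1 (value undefined outside h1) makes a map on h1 a unique
   function on the whole type. *)

definition Z_sh :: "ncpoly \<Rightarrow> real poly" where
  "Z_sh = (THE \<phi>. \<phi> \<in> extensional h1 \<and>
     (\<forall>f\<in>h1. \<forall>g\<in>h1. \<phi> (f + g) = \<phi> f + \<phi> g) \<and>
     (\<forall>c. \<forall>f\<in>h1. \<phi> (ncscale c f) = smult (of_rat c) (\<phi> f)) \<and>
     (\<forall>f\<in>h1. \<forall>g\<in>h1. \<phi> (shuffle_prod f g) = \<phi> f * \<phi> g) \<and>
     (\<forall>f\<in>h0. \<phi> f = [:Z f:]) \<and>
     \<phi> (of_word [E1]) = [:0, 1:])"

(* The pair (i, j), 1-based, is the element x_{i,j}; hence k_i is ks ! (i - 1). *)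

definition X_carrier :: "nat list \<Rightarrow> (nat \<times> nat) set" where
  "X_carrier ks = {(i, j). 1 \<le> i \<and> i \<le> length ks \<and> 1 \<le> j \<and> j \<le> ks ! (i - 1)}"

definition X_generators :: "nat list \<Rightarrow> ((nat \<times> nat) \<times> (nat \<times> nat)) set" where
  "X_generators ks =
     {((i, j), (i, j + 1)) | i j. 1 \<le> i \<and> i \<le> length ks \<and> 1 \<le> j \<and> j < ks ! (i - 1)} \<union>
     {((i, 1), (i + 1, ks ! i)) | i. 1 \<le> i \<and> i < length ks}"

definition X_less :: "nat list \<Rightarrow> ((nat \<times> nat) \<times> (nat \<times> nat)) set" where
  "X_less ks = (X_generators ks)\<^sup>+"

(* A linear extension of the strict order R on X is given by listing X in increasing order. *)

definition linear_extensions :: "'a set \<Rightarrow> ('a \<times> 'a) set \<Rightarrow> 'a list set" where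
  "linear_extensions X R = {xs. distinct xs \<and> set xs = X \<and>
     (\<forall>p<length xs. \<forall>q<length xs. (xs ! p, xs ! q) \<in> R \<longrightarrow> p < q)}"

definition X_label :: "nat \<times> nat \<Rightarrow> letter" where
  "X_label x = (if snd x = 1 then E1 else E0)"

definition w_poset :: "nat list \<Rightarrow> ncpoly" where
  "w_poset ks = (\<Sum>xs\<in>linear_extensions (X_carrier ks) (X_less ks). of_word (map X_label xs))"

definition zeta_star_sh :: "nat list \<Rightarrow> real poly" where
  "zeta_star_sh ks = Z_sh (w_poset ks)"

lemma inj_on_index_word: "inj_on index_word {ks. 0 \<notin> set ks}"
proof -
  have "ks = ls" if "0 \<notin> set ks" "0 \<notin> set ls" "index_word ks = index_word ls" for ks ls
    using that
  proof (induction ks arbitrary: ls)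
    case Nil
    then show ?case by (cases ls) (auto simp: index_word_def)
  next
    case (Cons k ks)
    have hd: "index_word xs = [] \<or> hd (index_word xs) = E1" for xs
      by (cases xs) (auto simp: index_word_def)
    have tw: "takeWhile (\<lambda>x. x = E0) (replicate n E0 @ index_word xs) = replicate n E0" for n xs
      using hd[of xs] by (induction n) (cases "index_word xs"; auto)+
    obtain l ls' where ls: "ls = l # ls'"
      using Cons.prems(3) by (cases ls) (auto simp: index_word_def)
    have eq: "replicate (k - 1) E0 @ index_word ks = replicate (l - 1) E0 @ index_word ls'"
      using Cons.prems(3) by (simp add: ls index_word_def)
    then have "takeWhile (\<lambda>x. x = E0) (replicate (k - 1) E0 @ index_word ks) =
        takeWhile (\<lambda>x. x = E0) (replicate (l - 1) E0 @ index_word ls')"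
      by (rule arg_cong)
    then have "replicate (k - 1) E0 = replicate (l - 1) E0" by (simp only: tw)
    then have len: "k - 1 = l - 1" by (drule_tac arg_cong[of _ _ length]) simp
    moreover have "k > 0" "l > 0" using Cons.prems(1,2) by (auto simp: ls)
    ultimately have "k = l" by linarith
    moreover have "ks = ls'"
      using Cons.IH[of ls'] Cons.prems(1,2) eq len by (simp add: ls)
    ultimately show ?case by (simp add: ls)
  qed
  then show ?thesis by (intro inj_onI) auto
qed

lemma word_index_index_word: "0 \<notin> set ks \<Longrightarrow> word_index (index_word ks) = ks"
  unfolding word_index_def by (rule inv_into_f_f[OF inj_on_index_word]) simp

end

theory Submission imports Defs begin

text \<open>
  Write \<open>w \<mapsto> P\<^sub>w\<close> for the regularized shuffle homomorphism on words; it extends the values \<open>Z w\<close>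
  of admissible words (those that start with \<open>e\<^sub>1\<close> and end with \<open>e\<^sub>0\<close>) and sends \<open>e\<^sub>1\<close> to \<open>T\<close>. The
  theorem rests on three facts.

  Combinatorics. The poset of the index \<open>({1}\<^sup>a, k, {1}\<^sup>b)\<close> consists of a chain of \<open>k\<close> elements, a
  chain of \<open>a\<close> elements below its top, and a chain of \<open>b\<close> elements above its bottom. The largest
  element of a linear extension is the top of the first or of the last chain, and once the top of
  the first chain is gone the poset falls apart. This gives the sum of words
  \<open>\<Sum>c\<le>b. (e\<^sub>1\<^sup>a sh e\<^sub>1 (e\<^sub>0\<^bsup>k-2\<^esup> sh e\<^sub>1\<^sup>c)) e\<^sub>0 e\<^sub>1\<^bsup>b-c\<^esup>\<close>. On the other hand, counting the letters
  behind the \<open>e\<^sub>0\<close> at the end of \<open>u e\<^sub>0\<close> in a shuffle shows that \<open>e\<^sub>1\<^sup>N sh u e\<^sub>0 = \<Sum>d\<le>N. (e\<^sub>1\<^bsup>N-d\<^esup> sh u) e\<^sub>0 e\<^sub>1\<^sup>d\<close>. Summed over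
  \<open>a + b = r - 1\<close>, the words of the posets therefore add up to
  \<open>\<Sum>c<r. e\<^sub>1\<^bsup>r-1-c\<^esup> sh e\<^sub>1 (e\<^sub>0\<^bsup>k-2\<^esup> sh e\<^sub>1\<^sup>c) e\<^sub>0\<close> (\<open>sum_hooks\<close>).

  Regularization. For a word \<open>w\<close> that starts with \<open>e\<^sub>1\<close> the polylogarithm \<open>Li w z\<close> turns shuffles
  into products, and for \<open>z \<rightarrow> 1\<close> it equals a polynomial \<open>P\<^sub>w\<close> in \<open>T = - ln (1 - z)\<close> up to an error
  that is negligible against all powers of \<open>T\<close>. Such a polynomial is unique, so \<open>w \<mapsto> P\<^sub>w\<close> is
  multiplicative. That no other map has the required properties follows from
  \<open>e\<^sub>1 sh v e\<^sub>1\<^sup>n = (n + 1) v e\<^sub>1\<^bsup>n+1\<^esup> + \<dots>\<close>, where the remaining words have only \<open>n\<close> trailing \<open>e\<^sub>1\<close>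
  (\<open>Z_sh_eq_reg_poly\<close>). In particular \<open>e\<^sub>1\<^sup>j\<close> goes to \<open>T\<^sup>j / j!\<close>.

  Sum formula. What remains is that the words of \<open>e\<^sub>1 (e\<^sub>0\<^sup>p sh e\<^sub>1\<^sup>q) e\<^sub>0\<close>, which are all admissible words
  with \<open>p + 1\<close> letters \<open>e\<^sub>0\<close> and \<open>q + 1\<close> letters \<open>e\<^sub>1\<close>, have values with sum \<open>\<zeta>(p + q + 2)\<close>
  (\<open>sum_formula\<close>). Weighted by \<open>x\<^sup>p y\<^sup>q\<close>, these values add up to a hypergeometric series that can be
  summed by telescoping to \<open>\<Sum>m\<ge>1. 1 / ((m - x) (m - y))\<close>, and the coefficients of this function
  are the zeta values.
\<close>

section \<open>Shuffles of words\<close>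

lemma shuffle_words_Nil_right [simp]: "shuffle_words u [] = {#u#}"
  by (cases u) auto

text \<open>Shuffles are defined by their first letters, but iterated integrals and linear extensions grow at
  the last letter, so the recursion is needed at the other end as well.\<close>

lemma shuffle_words_snoc:
  "shuffle_words (u @ [a]) (v @ [b]) =
     image_mset (\<lambda>w. w @ [a]) (shuffle_words u (v @ [b])) +
     image_mset (\<lambda>w. w @ [b]) (shuffle_words (u @ [a]) v)"
proof (induction u v rule: shuffle_words.induct)
  case (1 v)
  then show ?case
    by (induction v) (auto simp: multiset.map_comp o_def)
next
  case (2 x u)
  have "shuffle_words (w @ [a]) [b] =
     image_mset (\<lambda>w. w @ [a]) (shuffle_words w [b]) + {#w @ [a] @ [b]#}" for w
    by (induction w) (auto simp: multiset.map_comp o_def)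
  from this[of "x # u"] show ?case by simp
next
  case (3 x u y v)
  show ?case
    using 3 by (simp add: multiset.map_comp o_def add_ac)
qed

abbreviation e1_word :: "letter list \<Rightarrow> bool" where
  "e1_word w \<equiv> w = [] \<or> hd w = E1"

lemma shuffle_words_e1_word:
  "\<lbrakk>e1_word u; e1_word v; w \<in># shuffle_words u v\<rbrakk> \<Longrightarrow> e1_word w"
  by (cases u; cases v) auto

lemma length_shuffle_words: "w \<in># shuffle_words u v \<Longrightarrow> length w = length u + length v"
  by (induction u v arbitrary: w rule: shuffle_words.induct) auto

text \<open>Carries shuffles of poset elements to shuffles of their labels.\<close>

lemma image_mset_map_shuffle_words:
  "image_mset (map f) (shuffle_words u v) = shuffle_words (map f u) (map f v)"
  by (induction u v rule: shuffle_words.induct)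
     (simp_all add: multiset.map_comp o_def, simp flip: multiset.map_comp[unfolded o_def])

lemma sum_mset_sum_swap:
  "(\<Sum>v\<in>#M. \<Sum>d\<in>A. f v d) = (\<Sum>d\<in>A. \<Sum>v\<in>#M. f v d :: 'b :: comm_monoid_add)"
  by (induction M) (simp_all add: sum.distrib)

section \<open>Power series of multiple polylogarithms\<close>

text \<open>The product with the differential form of a letter, \<open>dt / t\<close> for \<^term>\<open>E0\<close> and \<open>dt / (1 - t)\<close> for
  \<^term>\<open>E1\<close>. The shift is the quotient by \<open>t\<close> only for a series without constant term.\<close>

fun letter_form :: "letter \<Rightarrow> real fps \<Rightarrow> real fps" where
  "letter_form E0 f = fps_shift 1 f"
| "letter_form E1 f = f * Abs_fps (\<lambda>_. 1)"

text \<open>The iterated integral of a word as a power series in the upper end of integration. The letters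
  are read from the smallest variable, so a new last letter is a new outermost integration.\<close>

definition polylog :: "letter list \<Rightarrow> real fps" where
  "polylog w = foldl (\<lambda>f c. fps_integral0 (letter_form c f)) 1 w"

lemma polylog_Nil [simp]: "polylog [] = 1"
  by (simp add: polylog_def)

lemma polylog_snoc: "polylog (w @ [c]) = fps_integral0 (letter_form c (polylog w))"
  by (simp add: polylog_def)

lemma polylog_snoc_E0_nth: "fps_nth (polylog (w @ [E0])) n = fps_nth (polylog w) n / real n"
  by (cases n) (auto simp: polylog_snoc fps_integral_def divide_simps)

lemma polylog_snoc_E1_nth:
  "fps_nth (polylog (w @ [E1])) n = (\<Sum>m<n. fps_nth (polylog w) m) / real n"
  by (cases n) (auto simp: polylog_snoc fps_integral_def fps_mult_nth divide_simps
      lessThan_Suc_atMost atLeast0AtMost)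

lemma polylog_nth_0: "w \<noteq> [] \<Longrightarrow> fps_nth (polylog w) 0 = 0"
  by (cases w rule: rev_cases) (auto simp: polylog_snoc fps_integral_def)

lemma letter_form_mult:
  assumes "c = E1 \<or> fps_nth f 0 = 0"
  shows "letter_form c f * g = letter_form c (f * g)"
proof (cases c)
  case E0
  then have f: "f = fps_X * fps_shift 1 f"
    using assms by (auto simp: fps_eq_iff)
  have "fps_shift 1 (fps_X * (fps_shift 1 f * g)) = fps_shift 1 f * g"
    by (rule fps_ext) simp
  also have "fps_X * (fps_shift 1 f * g) = f * g"
    by (subst (2) f) (simp add: mult.assoc)
  finally show ?thesis by (simp add: E0)
qed (simp add: mult_ac)

lemma letter_form_sum_mset:
  "letter_form c (\<Sum>w\<in>#M. f w) = (\<Sum>w\<in>#M. letter_form c (f w))"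
proof (cases c)
  case E0
  then show ?thesis by (induction M) (auto simp: fps_shift_add)
next
  case E1
  then show ?thesis by (induction M) (auto simp: distrib_right)
qed

lemma fps_deriv_sum_mset: "fps_deriv (\<Sum>w\<in>#M. f w) = (\<Sum>w\<in>#M. fps_deriv (f w))"
  by (induction M) auto

lemma fps_nth_sum_mset: "fps_nth (\<Sum>w\<in>#M. f w) n = (\<Sum>w\<in>#M. fps_nth (f w) n)"
  by (induction M) auto

lemma fps_deriv_polylog_snoc: "fps_deriv (polylog (w @ [c])) = letter_form c (polylog w)"
  by (simp add: polylog_snoc fps_deriv_fps_integral)

text \<open>By the product rule, differentiating a product of two iterated integrals strips the last letter
  off one of the two words, which is the recursion of the shuffles at their ends. That the words
  start with \<^term>\<open>E1\<close> ensures that only series without constant term are divided by \<open>t\<close>.\<close>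

lemma polylog_shuffle:
  assumes "e1_word u" "e1_word v"
  shows "polylog u * polylog v = (\<Sum>w\<in>#shuffle_words u v. polylog w)"
  using assms
proof (induction "length u + length v" arbitrary: u v rule: less_induct)
  case less
  show ?case
  proof (cases u rule: rev_cases)
    case Nil
    then show ?thesis by simp
  next
    case u: (snoc u' a)
    show ?thesis
    proof (cases v rule: rev_cases)
      case Nil
      then show ?thesis by simp
    next
      case v: (snoc v' b)
      have e1: "e1_word u'" "e1_word v'" and
        a: "a = E1 \<or> fps_nth (polylog u') 0 = 0" and b: "b = E1 \<or> fps_nth (polylog v') 0 = 0"
        using less.prems polylog_nth_0[of u'] polylog_nth_0[of v']
        unfolding u v by (auto simp: hd_append split: if_splits)
      have ih1: "polylog u' * polylog v = (\<Sum>w\<in>#shuffle_words u' v. polylog w)"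
        using less e1 u by simp
      have ih2: "polylog u * polylog v' = (\<Sum>w\<in>#shuffle_words u v'. polylog w)"
        using less e1 v by simp
      have "fps_deriv (polylog u * polylog v) =
          letter_form a (polylog u') * polylog v + letter_form b (polylog v') * polylog u"
        by (simp add: u v fps_deriv_polylog_snoc mult_ac)
      also have "\<dots> = letter_form a (polylog u' * polylog v) + letter_form b (polylog u * polylog v')"
        by (simp only: letter_form_mult[OF a] letter_form_mult[OF b] mult.commute[of "polylog v'"])
      also have "\<dots> = fps_deriv (\<Sum>w\<in>#shuffle_words u v. polylog w)"
        unfolding ih1 ih2
        unfolding u v shuffle_words_snoc
        by (simp add: fps_deriv_sum_mset letter_form_sum_mset multiset.map_comp o_def
            fps_deriv_polylog_snoc)
      finally have deriv: "fps_deriv (polylog u * polylog v) =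
          fps_deriv (\<Sum>w\<in>#shuffle_words u v. polylog w)" .
      have "fps_nth (polylog w) 0 = 0" if "w \<in># shuffle_words u v" for w
        using length_shuffle_words[OF that] by (intro polylog_nth_0) (auto simp: u)
      then have "fps_nth (\<Sum>w\<in>#shuffle_words u v. polylog w) 0 = 0"
        unfolding fps_nth_sum_mset by (intro sum_mset.neutral) auto
      moreover have "fps_nth (polylog u * polylog v) 0 = 0"
        using polylog_nth_0[of u] by (simp add: u)
      ultimately show ?thesis
        using deriv[unfolded fps_deriv_eq_iff] by simp
    qed
  qed
qed

lemma polylog_nth_bounds: "0 \<le> fps_nth (polylog w) n \<and> fps_nth (polylog w) n \<le> 1"
proof (induction w arbitrary: n rule: rev_induct)
  case (snoc c w)
  show ?case
  proof (cases c)
    case E0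
    have "fps_nth (polylog w) n / real n \<le> 1"
    proof (cases "n = 0")
      case False
      then show ?thesis using snoc[of n] by (simp add: divide_le_eq)
    qed simp
    then show ?thesis using E0 snoc[of n] by (simp add: polylog_snoc_E0_nth)
  next
    case E1
    have "(\<Sum>m<n. fps_nth (polylog w) m) \<le> (\<Sum>m<n. 1)"
      using snoc by (intro sum_mono) auto
    moreover have "(\<Sum>m<n. fps_nth (polylog w) m) \<ge> 0"
      using snoc by (intro sum_nonneg) auto
    ultimately show ?thesis
      using E1 by (cases "n = 0") (auto simp: polylog_snoc_E1_nth divide_le_eq)
  qed
qed auto

lemma polylog_nth_nonneg [simp]: "0 \<le> fps_nth (polylog w) n"
  and polylog_nth_le_1 [simp]: "fps_nth (polylog w) n \<le> 1"
  using polylog_nth_bounds by auto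

lemma sum_inverse_sqrt_le: "(\<Sum>m<Suc n. 1 / sqrt (real m)) \<le> 2 * sqrt (real n)"
proof (induction n)
  case (Suc n)
  define a b where "a = sqrt (real n)" and "b = sqrt (real (Suc n))"
  have b: "b > 0" "b\<^sup>2 = a\<^sup>2 + 1" by (auto simp: a_def b_def)
  have "2 * a * b + 1 \<le> 2 * b\<^sup>2"
    using b(2) zero_le_power2[of "a - b"] by (simp add: power2_diff)
  then have "2 * a + 1 / b \<le> 2 * b"
    using b(1) by (simp add: field_simps power2_eq_square)
  then show ?case using Suc by (simp add: a_def b_def)
qed simp

text \<open>The true size is at most a power of \<open>ln n\<close> over \<open>n\<close>. The weaker bound is used because it reproduces itself
  under averaging: a new letter \<^term>\<open>E1\<close> only doubles the constant.\<close>

lemma polylog_nth_decay: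
  assumes "w \<noteq> []" "e1_word w"
  shows "\<exists>C. \<forall>n. fps_nth (polylog w) n \<le> C / sqrt (real n)"
  using assms
proof (induction w rule: rev_induct)
  case (snoc c w)
  show ?case
  proof (cases "w = []")
    case True
    have "fps_nth (polylog [E1]) n \<le> 1 / sqrt (real n)" for n
    proof (cases "n = 0")
      case False
      have "(\<Sum>m<n. fps_nth (1 :: real fps) m) = 1"
        using False by (simp add: sum.delta)
      then have "fps_nth (polylog [E1]) n = 1 / real n"
        using polylog_snoc_E1_nth[of "[]" n] by simp
      moreover have "sqrt (real n) \<le> real n"
        using False by (intro real_le_lsqrt) (auto simp: power2_eq_square)
      ultimately show ?thesis using False by (simp add: frac_le)
    qed (auto simp: polylog_nth_0)
    then show ?thesis using True snoc.prems by auto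
  next
    case False
    then obtain C where C: "\<And>n. fps_nth (polylog w) n \<le> C / sqrt (real n)"
      using snoc by auto
    have C0: "C \<ge> 0"
      using C[of 1] polylog_nth_nonneg[of w 1] by (simp del: polylog_nth_nonneg)
    show ?thesis
    proof (cases c)
      case E0
      have "fps_nth (polylog w) n / real n \<le> C / sqrt (real n)" for n
      proof (cases "n = 0")
        case False
        then have "fps_nth (polylog w) n / real n \<le> fps_nth (polylog w) n / 1"
          by (intro divide_left_mono) auto
        then show ?thesis using C[of n] by linarith
      qed simp
      then show ?thesis using E0 by (auto simp: polylog_snoc_E0_nth)
    next
      case E1
      have "(\<Sum>m<n. fps_nth (polylog w) m) / real n \<le> (2 * C) / sqrt (real n)" for n
      proof (cases n)
        case (Suc l)
        have "(\<Sum>m<n. fps_nth (polylog w) m) \<le> (\<Sum>m<n. C * (1 / sqrt (real m)))"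
          using C by (intro sum_mono) auto
        also have "\<dots> = C * (\<Sum>m<n. 1 / sqrt (real m))"
          by (simp add: sum_distrib_left)
        also have "\<dots> \<le> C * (2 * sqrt (real l))"
          using C0 sum_inverse_sqrt_le[of l] Suc by (intro mult_left_mono) auto
        also have "\<dots> \<le> C * (2 * sqrt (real n))"
          using C0 Suc by (intro mult_left_mono) auto
        finally have "(\<Sum>m<n. fps_nth (polylog w) m) / real n \<le> C * (2 * sqrt (real n)) / real n"
          by (intro divide_right_mono) auto
        also have "\<dots> = 2 * C / sqrt (real n)"
          using real_div_sqrt[of "real n"] Suc by (simp add: field_simps)
        finally show ?thesis .
      qed auto
      then show ?thesis using E1 by (auto simp: polylog_snoc_E1_nth)
    qed
  qed
qed auto

section \<open>Multiple zeta values as polylogarithms at 1\<close>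

lemma index_word_snoc: "index_word (ks @ [k]) = index_word ks @ E1 # replicate (k - 1) E0"
  by (simp add: index_word_def)

lemma e1_word_index_word: "e1_word (index_word ks)"
  by (cases ks) (auto simp: index_word_def)

lemma e1_word_eq_index_word:
  assumes "e1_word w"
  obtains ks where "0 \<notin> set ks" "w = index_word ks"
proof -
  have "\<exists>ks. 0 \<notin> set ks \<and> w = index_word ks"
    using assms
  proof (induction w rule: rev_induct)
    case (snoc c w)
    then have "e1_word w" by (cases w) auto
    then obtain ks where ks: "0 \<notin> set ks" "w = index_word ks"
      using snoc.IH by auto
    show ?case
    proof (cases c)
      case E1
      then show ?thesis using ks by (intro exI[of _ "ks @ [1]"]) (simp add: index_word_snoc)
    next
      case E0
      then have "ks \<noteq> []" using ks snoc.prems by (auto simp: index_word_def)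
      then obtain ks' k where k: "ks = ks' @ [k]" by (cases ks rule: rev_cases) auto
      have "k = Suc (k - 1)" using ks(1) k by (cases k) auto
      then have "w @ [c] = index_word (ks' @ [Suc k])"
        using ks(2) E0 unfolding k index_word_snoc
        by (metis append.assoc append_Cons diff_Suc_1 replicate_Suc replicate_append_same)
      then show ?thesis using ks(1) k by (intro exI[of _ "ks' @ [Suc k]"]) auto
    qed
  qed (auto intro: exI[of _ "[]"] simp: index_word_def)
  then show ?thesis using that by blast
qed

lemma polylog_append_E0s_nth:
  "fps_nth (polylog (w @ replicate j E0)) n = fps_nth (polylog w) n / real n ^ j"
proof (induction j)
  case (Suc j)
  have "w @ replicate (Suc j) E0 = (w @ replicate j E0) @ [E0]"
    by (simp add: replicate_append_same)
  then show ?case using Suc by (simp only: polylog_snoc_E0_nth) simp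
qed simp

text \<open>The part of the summation range of a multiple zeta value where the largest entry is \<open>n\<close>. The
  leading 0 assigns the empty list to \<open>n = 0\<close>, in accordance with the constant term of the series
  of the empty word.\<close>

definition mzv_range_at :: "nat \<Rightarrow> nat \<Rightarrow> nat list set" where
  "mzv_range_at l n = {m. length m = l \<and> sorted_wrt (<) (0 # m) \<and> last (0 # m) = n}"

lemma le_last_if_sorted:
  fixes m :: "nat list"
  shows "sorted_wrt (<) (0 # m) \<Longrightarrow> x \<in> set m \<Longrightarrow> x \<le> last (0 # m)"
  by (cases m rule: rev_cases) (auto simp: sorted_wrt_append less_imp_le)

lemma finite_mzv_range_at: "finite (mzv_range_at l n)"
  by (rule finite_subset[OF _ finite_lists_length_eq[of "{..n}" l]])
     (use le_last_if_sorted in \<open>fastforce simp: mzv_range_at_def\<close>)+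

lemma mzv_range_at_Suc:
  "mzv_range_at (Suc l) n = (\<lambda>m. m @ [n]) ` (\<Union>j<n. mzv_range_at l j)"
proof (intro equalityI subsetI)
  fix m assume m: "m \<in> mzv_range_at (Suc l) n"
  then obtain m' where m': "m = m' @ [n]"
    by (cases m rule: rev_cases) (auto simp: mzv_range_at_def)
  have "last (0 # m') < n" "m' \<in> mzv_range_at l (last (0 # m'))"
    using m unfolding m' mzv_range_at_def by (auto simp: sorted_wrt_append)
  then show "m \<in> (\<lambda>m. m @ [n]) ` (\<Union>j<n. mzv_range_at l j)"
    using m' by blast
next
  fix m assume "m \<in> (\<lambda>m. m @ [n]) ` (\<Union>j<n. mzv_range_at l j)"
  then obtain m' where m': "m = m' @ [n]" "last (0 # m') < n" "sorted_wrt (<) (0 # m')"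
      "length m' = l"
    by (auto simp: mzv_range_at_def)
  have "x < n" if "x \<in> set m'" for x
    using le_last_if_sorted[OF m'(3) that] m'(2) by linarith
  then show "m \<in> mzv_range_at (Suc l) n"
    using m' unfolding mzv_range_at_def by (auto simp: sorted_wrt_append)
qed

text \<open>A further entry \<open>k\<close> of the index adds a letter \<^term>\<open>E1\<close>, which sums over all smaller values of the
  previous entry, and \<open>k - 1\<close> letters \<^term>\<open>E0\<close>; each of these \<open>k\<close> integrations divides by \<open>n\<close>.\<close>

lemma polylog_index_word_nth:
  assumes "0 \<notin> set ks"
  shows "fps_nth (polylog (index_word ks)) n =
    (\<Sum>m\<in>mzv_range_at (length ks) n. 1 / (\<Prod>i<length ks. real (m ! i) ^ (ks ! i)))"
  using assms
proof (induction ks arbitrary: n rule: rev_induct)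
  case Nil
  have "mzv_range_at 0 n = (if n = 0 then {[]} else {})"
    by (auto simp: mzv_range_at_def)
  then show ?case by (simp add: index_word_def)
next
  case (snoc k ks)
  let ?l = "length ks"
  let ?f = "\<lambda>m. 1 / (\<Prod>i<?l. real (m ! i) ^ (ks ! i))"
  have k: "k = Suc (k - 1)" using snoc.prems by (cases k) auto
  have "fps_nth (polylog (index_word (ks @ [k]))) n =
      fps_nth (polylog ((index_word ks @ [E1]) @ replicate (k - 1) E0)) n"
    by (simp add: index_word_snoc)
  also have "\<dots> = (\<Sum>j<n. fps_nth (polylog (index_word ks)) j) / real n ^ k"
    unfolding polylog_append_E0s_nth polylog_snoc_E1_nth by (subst (2) k) simp
  also have "\<dots> = (\<Sum>j<n. \<Sum>m\<in>mzv_range_at ?l j. ?f m) / real n ^ k"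
    using snoc by simp
  also have "\<dots> = (\<Sum>m\<in>(\<Union>j<n. mzv_range_at ?l j). ?f m / real n ^ k)"
    by (subst sum.UNION_disjoint)
       (auto simp: finite_mzv_range_at sum_divide_distrib, auto simp: mzv_range_at_def)
  also have "\<dots> = (\<Sum>m\<in>(\<Union>j<n. mzv_range_at ?l j).
      1 / (\<Prod>i<length (ks @ [k]). real ((m @ [n]) ! i) ^ ((ks @ [k]) ! i)))"
    by (intro sum.cong) (auto simp: mzv_range_at_def nth_append)
  also have "\<dots> = (\<Sum>m\<in>mzv_range_at (length (ks @ [k])) n.
      1 / (\<Prod>i<length (ks @ [k]). real (m ! i) ^ ((ks @ [k]) ! i)))"
    using mzv_range_at_Suc[of ?l n] by (simp add: sum.reindex inj_on_def)
  finally show ?case .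
qed

text \<open>The final \<^term>\<open>E0\<close> contributes a factor \<open>1 / n\<close>, which makes the coefficients summable.\<close>

lemma admissible_decay:
  assumes "e1_word w" "w = [] \<or> last w = E0"
  obtains C where "\<And>n. n > 0 \<Longrightarrow> fps_nth (polylog w) n \<le> C * real n powr (-3/2)"
proof (cases "w = []")
  case True
  then show ?thesis using that[of 0] by simp
next
  case False
  then obtain v where w: "w = v @ [E0]" using assms by (cases w rule: rev_cases) auto
  have "v \<noteq> []" "e1_word v" using assms w by (auto simp: hd_append split: if_splits)
  then obtain C where C: "\<And>n. fps_nth (polylog v) n \<le> C / sqrt (real n)"
    using polylog_nth_decay by blast
  have "fps_nth (polylog w) n \<le> C * real n powr (-3/2)" if "n > 0" for n
  proof -
    have "sqrt (real n) * real n = real n powr (1/2) * real n powr 1"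
      using that by (simp add: powr_half_sqrt)
    also have "\<dots> = real n powr (3/2)"
      by (subst powr_add[symmetric]) simp
    finally have "C / (sqrt (real n) * real n) = C * real n powr (-3/2)"
      by (simp add: powr_minus_divide)
    moreover have "fps_nth (polylog v) n / real n \<le> C / sqrt (real n) / real n"
      using C by (intro divide_right_mono) auto
    ultimately show ?thesis by (simp add: w polylog_snoc_E0_nth)
  qed
  then show ?thesis using that by blast
qed

lemma admissible_summable:
  assumes "e1_word w" "w = [] \<or> last w = E0"
  shows "summable (\<lambda>n. fps_nth (polylog w) n)"
proof -
  obtain C where C: "\<And>n. n > 0 \<Longrightarrow> fps_nth (polylog w) n \<le> C * real n powr (-3/2)"
    using admissible_decay[OF assms] by blast
  show ?thesis
  proof (rule summable_comparison_test')
    show "summable (\<lambda>n. C * real n powr (-3/2))"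
      by (intro summable_mult) (simp add: summable_real_powr_iff)
    show "norm (fps_nth (polylog w) n) \<le> C * real n powr (-3/2)" if "n \<ge> 1" for n
      using C[of n] that by simp
  qed
qed

text \<open>The multiple series is grouped by its largest entry; all terms are nonnegative.\<close>

lemma mzv_eq_suminf_polylog:
  assumes "0 \<notin> set ks" "ks = [] \<or> last ks > 1"
  shows "mzv ks = suminf (fps_nth (polylog (index_word ks)))"
proof -
  let ?l = "length ks" and ?a = "fps_nth (polylog (index_word ks))"
  define f where "f m = 1 / (\<Prod>i<?l. real (m ! i) ^ (ks ! i))" for m :: "nat list"
  let ?M = "{m :: nat list. length m = ?l \<and> (\<forall>x\<in>set m. 0 < x) \<and> sorted_wrt (<) m}"
  have last: "index_word ks = [] \<or> last (index_word ks) = E0"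
    using assms(2) by (cases ks rule: rev_cases) (auto simp: index_word_snoc index_word_def)
  have sums: "?a sums (suminf ?a)"
    using admissible_summable[OF e1_word_index_word last] by (rule summable_sums)
  have outer: "(?a has_sum (suminf ?a)) UNIV"
    using sums by (intro sums_nonneg_imp_has_sum) auto
  have inner: "((\<lambda>m. (f \<circ> snd) (n, m)) has_sum ?a n) (mzv_range_at ?l n)" for n
    using has_sum_finite[OF finite_mzv_range_at, of f ?l n]
    by (simp add: f_def[abs_def] polylog_index_word_nth[OF assms(1)])
  have nonneg: "f m \<ge> 0" for m by (simp add: f_def prod_nonneg)
  have "(f \<circ> snd) summable_on (Sigma UNIV (mzv_range_at ?l))"
    using inner by (rule summable_on_SigmaI[OF _ has_sum_imp_summable[OF outer]]) (auto simp: nonneg)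
  then have "((f \<circ> snd) has_sum (suminf ?a)) (Sigma UNIV (mzv_range_at ?l))"
    using inner outer by (intro has_sum_SigmaI) auto
  moreover have "inj_on snd (Sigma UNIV (mzv_range_at ?l))"
    by (auto simp: inj_on_def mzv_range_at_def)
  ultimately have "(f has_sum (suminf ?a)) (snd ` Sigma UNIV (mzv_range_at ?l))"
    by (simp add: has_sum_reindex)
  moreover have "snd ` Sigma UNIV (mzv_range_at ?l) = ?M"
    by (auto simp: mzv_range_at_def image_iff)
  ultimately show ?thesis
    unfolding mzv_def f_def by (simp add: infsumI)
qed

lemma mzv_word_index:
  assumes "e1_word w" "w = [] \<or> last w = E0"
  shows "mzv (word_index w) = suminf (fps_nth (polylog w))"
proof -
  obtain ks where ks: "0 \<notin> set ks" "w = index_word ks"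
    using e1_word_eq_index_word[OF assms(1)] .
  have "ks = [] \<or> last ks > 1"
    using assms(2) ks by (cases ks rule: rev_cases) (auto simp: index_word_snoc split: if_splits)
  then show ?thesis using ks by (simp add: word_index_index_word mzv_eq_suminf_polylog)
qed

section \<open>Expansions in powers of the logarithm at 1\<close>

lemma sums_sum_mset:
  assumes "\<And>v. v \<in># M \<Longrightarrow> (\<lambda>n. f v n) sums (g v :: real)"
  shows "(\<lambda>n. \<Sum>v\<in>#M. f v n) sums (\<Sum>v\<in>#M. g v)"
  using assms by (induction M) (auto intro!: sums_add)

text \<open>For \<open>T = - ln (1 - z)\<close> and \<open>z \<rightarrow> 1\<close>, the value \<open>f z\<close> is \<open>poly P T\<close> up to an error that beats every
  power of \<open>T\<close>. Asking for all powers makes the errors stable under products with polynomials, and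
  hence makes expansions multiplicative.\<close>

definition log_expansion :: "(real \<Rightarrow> real) \<Rightarrow> real poly \<Rightarrow> bool" where
  "log_expansion f P \<longleftrightarrow> (\<forall>N. ((\<lambda>T. (f (1 - exp (- T)) - poly P T) * T ^ N) \<longlongrightarrow> 0) at_top)"

text \<open>A polynomial that tends to 0 at infinity is 0.\<close>

lemma log_expansion_unique:
  assumes "log_expansion f P" "log_expansion f Q"
  shows "P = Q"
proof (rule ccontr)
  assume "P \<noteq> Q"
  have "((\<lambda>T. (f (1 - exp (- T)) - poly Q T) * T ^ 0 - (f (1 - exp (- T)) - poly P T) * T ^ 0)
      \<longlongrightarrow> 0 - 0) at_top"
    using assms unfolding log_expansion_def by (intro tendsto_diff) blast+
  then have lim: "(poly (P - Q) \<longlongrightarrow> 0) at_top" by (simp add: poly_diff[abs_def])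
  show False
  proof (cases "degree (P - Q) = 0")
    case True
    then obtain c where c: "P - Q = [:c:]" by (rule degree_eq_zeroE)
    moreover have "poly [:c:] = (\<lambda>T. c)" by (simp add: fun_eq_iff)
    ultimately have "((\<lambda>T :: real. c) \<longlongrightarrow> 0) at_top" using lim by simp
    then have "c = 0" by (simp add: tendsto_const_iff)
    then show False using c \<open>P \<noteq> Q\<close> by simp
  next
    case False
    then have "filterlim (poly (P - Q)) at_infinity at_infinity"
      by (intro filterlim_poly_at_infinity) simp
    then have "filterlim (poly (P - Q)) at_infinity at_top"
      using at_top_le_at_infinity by (rule filterlim_mono[OF _ order_refl])
    then show False
      using lim not_tendsto_and_filterlim_at_infinity[OF trivial_limit_at_top_linorder] by blast
  qed
qed

lemma log_expansion_cong:
  assumes "log_expansion f P" "\<And>z. 0 < z \<Longrightarrow> z < 1 \<Longrightarrow> f z = g z"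
  shows "log_expansion g P"
  unfolding log_expansion_def
proof
  fix N
  have "eventually (\<lambda>T :: real. f (1 - exp (- T)) = g (1 - exp (- T))) at_top"
    using eventually_gt_at_top[of 0] by eventually_elim (simp add: assms(2))
  then have "eventually (\<lambda>T. (f (1 - exp (- T)) - poly P T) * T ^ N =
      (g (1 - exp (- T)) - poly P T) * T ^ N) at_top"
    by eventually_elim simp
  from Lim_transform_eventually[OF _ this]
  show "((\<lambda>T. (g (1 - exp (- T)) - poly P T) * T ^ N) \<longlongrightarrow> 0) at_top"
    using assms(1) unfolding log_expansion_def by blast
qed

lemma log_expansion_add:
  assumes "log_expansion f P" "log_expansion g Q"
  shows "log_expansion (\<lambda>z. f z + g z) (P + Q)"
  unfolding log_expansion_def
proof
  fix N
  have "((\<lambda>T. (f (1 - exp (- T)) - poly P T) * T ^ N + (g (1 - exp (- T)) - poly Q T) * T ^ N)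
      \<longlongrightarrow> 0 + 0) at_top"
    using assms unfolding log_expansion_def by (intro tendsto_add) blast+
  then show "((\<lambda>T. (f (1 - exp (- T)) + g (1 - exp (- T)) - poly (P + Q) T) * T ^ N) \<longlongrightarrow> 0) at_top"
    by (simp add: algebra_simps)
qed

lemma log_expansion_cmult:
  assumes "log_expansion f P"
  shows "log_expansion (\<lambda>z. c * f z) (smult c P)"
  unfolding log_expansion_def
proof
  fix N
  have "((\<lambda>T. c * ((f (1 - exp (- T)) - poly P T) * T ^ N)) \<longlongrightarrow> c * 0) at_top"
    using assms unfolding log_expansion_def by (intro tendsto_mult tendsto_const) blast
  then show "((\<lambda>T. (c * f (1 - exp (- T)) - poly (smult c P) T) * T ^ N) \<longlongrightarrow> 0) at_top"
    by (simp add: algebra_simps)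
qed

lemma log_expansion_sum_mset:
  assumes "\<And>v. v \<in># M \<Longrightarrow> log_expansion (f v) (P v)"
  shows "log_expansion (\<lambda>z. \<Sum>v\<in>#M. f v z) (\<Sum>v\<in>#M. P v)"
  using assms
  by (induction M) (auto intro!: log_expansion_add simp: log_expansion_def[of "\<lambda>_. 0"])

lemma tendsto_error_times_poly:
  assumes "\<And>N. ((\<lambda>T. e T * T ^ N) \<longlongrightarrow> (0 :: real)) at_top"
  shows "((\<lambda>T. e T * poly Q T * T ^ N) \<longlongrightarrow> 0) at_top"
proof -
  have "((\<lambda>T. \<Sum>i\<le>degree Q. coeff Q i * (e T * T ^ (i + N))) \<longlongrightarrow> (\<Sum>i\<le>degree Q. coeff Q i * 0)) at_top"
    by (intro tendsto_sum tendsto_mult tendsto_const assms)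
  also have "(\<lambda>T. \<Sum>i\<le>degree Q. coeff Q i * (e T * T ^ (i + N))) = (\<lambda>T. e T * poly Q T * T ^ N)"
    by (auto simp: fun_eq_iff poly_altdef sum_distrib_left sum_distrib_right power_add mult_ac)
  finally show ?thesis by simp
qed

text \<open>If \<open>f = P + e\<close> and \<open>g = Q + e'\<close>, then \<open>f g - P Q = e e' + e Q + e' P\<close>.\<close>

lemma log_expansion_mult:
  assumes "log_expansion f P" "log_expansion g Q"
  shows "log_expansion (\<lambda>z. f z * g z) (P * Q)"
  unfolding log_expansion_def
proof
  fix N
  define e where "e T = f (1 - exp (- T)) - poly P T" for T
  define e' where "e' T = g (1 - exp (- T)) - poly Q T" for T
  have e: "((\<lambda>T. e T * T ^ N) \<longlongrightarrow> 0) at_top" "((\<lambda>T. e' T * T ^ N) \<longlongrightarrow> 0) at_top" for N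
    using assms by (auto simp: log_expansion_def e_def e'_def)
  have "((\<lambda>T. (e T * T ^ N) * (e' T * T ^ 0) + e T * poly Q T * T ^ N + e' T * poly P T * T ^ N)
      \<longlongrightarrow> 0 * 0 + 0 + 0) at_top"
    by (intro tendsto_add tendsto_mult tendsto_error_times_poly e)
  then show "((\<lambda>T. (f (1 - exp (- T)) * g (1 - exp (- T)) - poly (P * Q) T) * T ^ N) \<longlongrightarrow> 0) at_top"
    by (simp add: e_def e'_def algebra_simps)
qed

definition Li :: "letter list \<Rightarrow> real \<Rightarrow> real" where
  "Li w z = suminf (\<lambda>n. fps_nth (polylog w) n * z ^ n)"

lemma summable_norm_Li:
  assumes "0 < z" "z < 1"
  shows "summable (\<lambda>n. norm (fps_nth (polylog w) n * z ^ n))"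
proof (rule summable_comparison_test')
  show "summable (\<lambda>n. z ^ n)" using assms by (intro summable_geometric) simp
  show "norm (norm (fps_nth (polylog w) n * z ^ n)) \<le> z ^ n" if "n \<ge> 0" for n
    using assms mult_right_mono[of "fps_nth (polylog w) n" 1 "z ^ n"] by (simp add: abs_mult)
qed

lemma Li_sums:
  assumes "0 < z" "z < 1"
  shows "(\<lambda>n. fps_nth (polylog w) n * z ^ n) sums Li w z"
  unfolding Li_def using summable_norm_cancel[OF summable_norm_Li[OF assms]] by (rule summable_sums)

lemma Li_shuffle:
  assumes "e1_word u" "e1_word v" "0 < z" "z < 1"
  shows "Li u z * Li v z = (\<Sum>w\<in>#shuffle_words u v. Li w z)"
proof -
  have "(\<lambda>n. \<Sum>i\<le>n. (fps_nth (polylog u) i * z ^ i) * (fps_nth (polylog v) (n - i) * z ^ (n - i)))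
      sums (Li u z * Li v z)"
    unfolding Li_def by (intro Cauchy_product_sums summable_norm_Li assms)
  also have "(\<lambda>n. \<Sum>i\<le>n. (fps_nth (polylog u) i * z ^ i) * (fps_nth (polylog v) (n - i) * z ^ (n - i))) =
      (\<lambda>n. fps_nth (polylog u * polylog v) n * z ^ n)"
  proof
    fix n
    have eq: "(fps_nth (polylog u) i * z ^ i) * (fps_nth (polylog v) (n - i) * z ^ (n - i)) =
        fps_nth (polylog u) i * fps_nth (polylog v) (n - i) * z ^ n" if "i \<le> n" for i
    proof -
      have "z ^ n = z ^ i * z ^ (n - i)" using that by (simp flip: power_add)
      then show ?thesis by simp
    qed
    show "(\<Sum>i\<le>n. (fps_nth (polylog u) i * z ^ i) * (fps_nth (polylog v) (n - i) * z ^ (n - i))) =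
        fps_nth (polylog u * polylog v) n * z ^ n"
      unfolding fps_mult_nth sum_distrib_right atLeast0AtMost
      by (rule sum.cong[OF refl], rule eq, simp)
  qed
  also have "\<dots> = (\<lambda>n. \<Sum>w\<in>#shuffle_words u v. fps_nth (polylog w) n * z ^ n)"
    by (simp add: polylog_shuffle[OF assms(1,2)] fps_nth_sum_mset sum_mset_distrib_right)
  finally have "(\<lambda>n. \<Sum>w\<in>#shuffle_words u v. fps_nth (polylog w) n * z ^ n) sums (Li u z * Li v z)" .
  then show ?thesis
    using sums_sum_mset[of "shuffle_words u v", OF Li_sums[OF assms(3,4)]] by (rule sums_unique2)
qed

lemma Li_E1:
  assumes "0 < z" "z < 1"
  shows "Li [E1] z = - ln (1 - z)"
proof -
  have "(\<lambda>n. z ^ n / real n) sums - ln (1 - z)"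
    using sums_minus[OF ln_series'[of "- z"]] assms by simp
  also have "(\<lambda>n. z ^ n / real n) = (\<lambda>n. fps_nth (polylog [E1]) n * z ^ n)"
  proof
    fix n
    show "z ^ n / real n = fps_nth (polylog [E1]) n * z ^ n"
      using polylog_snoc_E1_nth[of "[]" n] by (cases "n = 0") (simp_all add: sum.delta)
  qed
  finally show ?thesis using Li_sums[OF assms] by (intro sums_unique2)
qed

lemma log_expansion_Li_E1: "log_expansion (Li [E1]) [:0, 1:]"
proof (rule log_expansion_cong)
  show "log_expansion (\<lambda>z. - ln (1 - z)) [:0, 1:]"
    by (simp add: log_expansion_def)
qed (simp add: Li_E1)

text \<open>The left side is at most 1 and at most \<open>n (1 - z)\<close>, hence at most any power of the latter with
  exponent in \<open>[0, 1]\<close>. The exponent \<open>1 / 4\<close> is small enough to leave \<open>n\<^bsup>-3/2\<^esup> n\<^bsup>1/4\<^esup>\<close> summable.\<close>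

lemma one_minus_power_le:
  fixes z :: real
  assumes "0 < z" "z < 1" "n > 0"
  shows "1 - z ^ n \<le> (real n * (1 - z)) powr (1 / 4)"
proof -
  have "z ^ n \<le> 1" using assms by (intro power_le_one) auto
  then have t: "0 \<le> 1 - z ^ n" "1 - z ^ n \<le> 1" using assms by auto
  have "1 - z ^ n \<le> (1 - z ^ n) powr (1 / 4)"
    using powr_mono'[of "1 / 4" 1 "1 - z ^ n"] t by simp
  also have "\<dots> \<le> (real n * (1 - z)) powr (1 / 4)"
    using Bernoulli_inequality[of "z - 1" n] assms t
    by (intro powr_mono2) (auto simp: algebra_simps)
  finally show ?thesis .
qed

text \<open>Abel's limit theorem with a rate: the error is \<open>O((1 - z)\<^bsup>1/4\<^esup>)\<close>, so it decays exponentially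
  in \<open>T\<close>.\<close>

lemma log_expansion_admissible:
  assumes "e1_word w" "w = [] \<or> last w = E0"
  shows "log_expansion (Li w) [:suminf (fps_nth (polylog w)):]"
proof -
  let ?a = "fps_nth (polylog w)"
  obtain C where C: "\<And>n. n > 0 \<Longrightarrow> ?a n \<le> C * real n powr (-3/2)"
    using admissible_decay[OF assms] by blast
  have C0: "C \<ge> 0" using C[of 1] polylog_nth_nonneg[of w 1] by (simp del: polylog_nth_nonneg)
  define K where "K = suminf (\<lambda>n. C * real n powr (-5/4))"
  have bound: "norm (Li w (1 - exp (- T)) - suminf ?a) \<le> K * exp (- T / 4)" if "T > 0" for T
  proof -
    define z where "z = 1 - exp (- T)"
    have z: "0 < z" "z < 1" using that by (auto simp: z_def)
    have sums: "(\<lambda>n. ?a n - ?a n * z ^ n) sums (suminf ?a - Li w z)"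
      by (intro sums_diff Li_sums z summable_sums admissible_summable assms)
    have nonneg: "0 \<le> ?a n - ?a n * z ^ n" for n
      using z power_le_one[of z n] mult_left_mono[of "z ^ n" 1 "?a n"] by simp
    have le: "?a n - ?a n * z ^ n \<le> C * real n powr (-5/4) * exp (- T / 4)" for n
    proof (cases "n = 0")
      case False
      have z1: "0 \<le> 1 - z ^ n" using power_le_one[of z n] z by simp
      have "?a n - ?a n * z ^ n = ?a n * (1 - z ^ n)" by (simp add: algebra_simps)
      also have "\<dots> \<le> (C * real n powr (-3/2)) * (real n * (1 - z)) powr (1 / 4)"
        using C[of n] one_minus_power_le[OF z, of n] False C0 z1 by (intro mult_mono) auto
      also have "(real n * (1 - z)) powr (1 / 4) = real n powr (1 / 4) * exp (- T / 4)"
        using False by (simp add: z_def powr_mult exp_powr_real)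
      also have "C * real n powr (-3/2) * (real n powr (1 / 4) * exp (- T / 4)) =
          C * (real n powr (-3/2) * real n powr (1 / 4)) * exp (- T / 4)"
        by simp
      also have "real n powr (-3/2) * real n powr (1 / 4) = real n powr (-5/4)"
        by (subst powr_add[symmetric]) simp
      finally show ?thesis .
    qed simp
    have "summable (\<lambda>n. C * real n powr (-5/4))"
      by (intro summable_mult) (simp add: summable_real_powr_iff)
    then have K: "(\<lambda>n. C * real n powr (-5/4) * exp (- T / 4)) sums (K * exp (- T / 4))"
      unfolding K_def by (intro sums_mult2 summable_sums)
    have "suminf ?a - Li w z \<le> K * exp (- T / 4)"
      using le sums K by (rule sums_le)
    moreover have "0 \<le> suminf ?a - Li w z"
      using nonneg sums_zero sums by (rule sums_le)
    ultimately show ?thesis by (simp add: z_def)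
  qed
  show ?thesis
    unfolding log_expansion_def
  proof
    fix N
    have "filterlim (\<lambda>T :: real. T / 4) at_top at_top"
      using filterlim_tendsto_pos_mult_at_top[OF tendsto_const[of "1 / 4 :: real"] _ filterlim_ident]
      by simp
    then have "((\<lambda>T. (T / 4) ^ N / exp (T / 4)) \<longlongrightarrow> (0 :: real)) at_top"
      by (rule filterlim_compose[OF tendsto_power_div_exp_0])
    then have "((\<lambda>T. (K * 4 ^ N) * ((T / 4) ^ N / exp (T / 4))) \<longlongrightarrow> (K * 4 ^ N) * 0) at_top"
      by (intro tendsto_mult tendsto_const)
    then have lim: "((\<lambda>T. K * exp (- T / 4) * T ^ N) \<longlongrightarrow> 0) at_top"
      by (simp add: power_divide exp_minus field_simps)
    show "((\<lambda>T. (Li w (1 - exp (- T)) - poly [:suminf ?a:] T) * T ^ N) \<longlongrightarrow> 0) at_top"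
    proof (rule Lim_null_comparison[OF _ lim])
      show "eventually (\<lambda>T. norm ((Li w (1 - exp (- T)) - poly [:suminf ?a:] T) * T ^ N)
          \<le> K * exp (- T / 4) * T ^ N) at_top"
        using eventually_gt_at_top[of 0]
      proof eventually_elim
        case (elim T)
        have "norm ((Li w (1 - exp (- T)) - suminf ?a) * T ^ N) =
            norm (Li w (1 - exp (- T)) - suminf ?a) * T ^ N"
          using elim by (simp add: abs_mult)
        also have "\<dots> \<le> K * exp (- T / 4) * T ^ N"
          using elim by (intro mult_right_mono bound) auto
        finally show ?case by simp
      qed
    qed
  qed
qed

text \<open>The new letter is inserted either among the trailing letters \<^term>\<open>E1\<close>, always with the same result,
  or into \<open>v\<close>; its insertion at the very end of \<open>v\<close> is counted in the second summand.\<close>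

lemma shuffle_E1_append_E1s:
  "shuffle_words [E1] (v @ replicate n E1) =
     replicate_mset n (v @ replicate (Suc n) E1) +
     image_mset (\<lambda>u. u @ replicate n E1) (shuffle_words [E1] v)"
proof (induction n)
  case (Suc n)
  have "shuffle_words [E1] (v @ replicate (Suc n) E1) =
      shuffle_words ([] @ [E1]) ((v @ replicate n E1) @ [E1])"
    by (simp add: replicate_append_same)
  also have "\<dots> = {#v @ replicate (Suc (Suc n)) E1#} +
      image_mset (\<lambda>w. w @ [E1]) (shuffle_words [E1] (v @ replicate n E1))"
    unfolding shuffle_words_snoc by (simp add: replicate_append_same)
  also have "\<dots> = replicate_mset (Suc n) (v @ replicate (Suc (Suc n)) E1) +
      image_mset (\<lambda>u. u @ replicate (Suc n) E1) (shuffle_words [E1] v)"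
    unfolding Suc by (simp add: multiset.map_comp o_def replicate_append_same)
  finally show ?case .
qed simp

text \<open>If \<open>v\<close> ends with \<^term>\<open>E0\<close>, an insertion before this letter leaves the number of trailing \<^term>\<open>E1\<close>
  unchanged, and all other insertions give the same word.\<close>

lemma shuffle_E1_admissible:
  assumes "e1_word v" "v = [] \<or> last v = E0"
  obtains M where
    "\<And>n. shuffle_words [E1] (v @ replicate n E1) = replicate_mset (Suc n) (v @ replicate (Suc n) E1) +
       image_mset (\<lambda>u. u @ replicate n E1) M"
    "\<And>u. u \<in># M \<Longrightarrow> e1_word u \<and> last u = E0"
proof (cases "v = []")
  case True
  then show ?thesis
    using that[of "{#}"] shuffle_E1_append_E1s[of "[]"] by simp
next
  case False
  then obtain v' where v: "v = v' @ [E0]" using assms(2) by (cases v rule: rev_cases) auto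
  have v': "e1_word v'" using assms(1) v by (auto simp: hd_append split: if_splits)
  let ?M = "image_mset (\<lambda>w. w @ [E0]) (shuffle_words [E1] v')"
  have "shuffle_words [E1] v = {#v @ [E1]#} + ?M"
    using shuffle_words_snoc[of "[]" E1 v' E0] by (simp add: v)
  then have "shuffle_words [E1] (v @ replicate n E1) = replicate_mset (Suc n) (v @ replicate (Suc n) E1) +
       image_mset (\<lambda>u. u @ replicate n E1) ?M" for n
    by (simp add: shuffle_E1_append_E1s)
  moreover have "e1_word u \<and> last u = E0" if "u \<in># ?M" for u
  proof -
    obtain u' where u': "u = u' @ [E0]" "u' \<in># shuffle_words [E1] v'" using \<open>u \<in># ?M\<close> by auto
    have "u' \<noteq> []" using length_shuffle_words[OF u'(2)] by auto
    then show ?thesis using u' shuffle_words_e1_word[OF _ v' u'(2)] by simp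
  qed
  ultimately show ?thesis by (rule that)
qed

text \<open>Induction on the number of trailing letters \<^term>\<open>E1\<close>. It replaces the theorem that \<^term>\<open>h1\<close> is
  generated by \<^term>\<open>h0\<close> and the letter \<open>e\<^sub>1\<close> under the shuffle product: in the step, \<open>w\<close> can be solved
  for in the product of \<open>e\<^sub>1\<close> and \<open>v\<close>. Both the existence and the uniqueness of the
  regularization follow this pattern.\<close>

lemma e1_word_induct [consumes 1, case_names admissible step]:
  assumes "e1_word w"
    and adm: "\<And>v. \<lbrakk>e1_word v; v = [] \<or> last v = E0\<rbrakk> \<Longrightarrow> P v"
    and step: "\<And>v w n M. \<lbrakk>e1_word v; P v; e1_word w; \<And>x. x \<in># M \<Longrightarrow> e1_word x \<and> P x;
       shuffle_words [E1] v = replicate_mset (Suc n) w + M\<rbrakk> \<Longrightarrow> P w"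
  shows "P w"
proof -
  have *: "P (v @ replicate n E1)" if "e1_word v" "v = [] \<or> last v = E0" for v n
    using that
  proof (induction n arbitrary: v)
    case (Suc n)
    obtain M where M: "\<And>n. shuffle_words [E1] (v @ replicate n E1) =
        replicate_mset (Suc n) (v @ replicate (Suc n) E1) + image_mset (\<lambda>u. u @ replicate n E1) M"
        "\<And>u. u \<in># M \<Longrightarrow> e1_word u \<and> last u = E0"
      using shuffle_E1_admissible[OF Suc.prems] by blast
    have e1: "e1_word (u @ replicate n E1)" if "e1_word u" for u n
      using that by (cases u; cases n) auto
    show ?case
    proof (rule step[OF e1[OF Suc.prems(1)] Suc.IH[OF Suc.prems] e1[OF Suc.prems(1)] _ M(1)])
      fix x assume "x \<in># image_mset (\<lambda>u. u @ replicate n E1) M"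
      then obtain u where u: "x = u @ replicate n E1" "u \<in># M" by auto
      then show "e1_word x \<and> P x" using M(2)[OF u(2)] Suc.IH[of u] e1[of u n] by simp
    qed
  qed (use adm in simp)
  define n where "n = length (takeWhile (\<lambda>c. c = E1) (rev w))"
  define v where "v = rev (dropWhile (\<lambda>c. c = E1) (rev w))"
  have tw: "takeWhile (\<lambda>c. c = E1) (rev w) = replicate n E1"
    unfolding n_def by (metis (full_types) replicate_eqI set_takeWhileD)
  have w: "w = v @ replicate n E1"
    using takeWhile_dropWhile_id[of "\<lambda>c. c = E1" "rev w"] unfolding tw v_def
    by (metis rev_append rev_replicate rev_rev_ident)
  have "v = [] \<or> last v = E0"
    using hd_dropWhile[of "\<lambda>c. c = E1" "rev w"] letter.exhaust
    unfolding v_def by (metis last_rev rev_is_Nil_conv)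
  moreover have "e1_word v" using assms(1) w by (cases v) auto
  ultimately show ?thesis using * w by simp
qed

text \<open>The regularized value of a word: the polynomial in \<open>- ln (1 - z)\<close> that its polylogarithm approaches
  at \<open>z = 1\<close>.\<close>

definition reg :: "letter list \<Rightarrow> real poly" where
  "reg w = (THE P. log_expansion (Li w) P)"

lemma reg_eqI: "log_expansion (Li w) P \<Longrightarrow> reg w = P"
  unfolding reg_def using log_expansion_unique by blast

lemma log_expansion_reg:
  assumes "e1_word w"
  shows "log_expansion (Li w) (reg w)"
  using assms
proof (induct rule: e1_word_induct)
  case (admissible v)
  then show ?case using log_expansion_admissible reg_eqI by metis
next
  case (step v w n M)
  let ?P = "smult (1 / real (Suc n)) ([:0, 1:] * reg v + smult (- 1) (\<Sum>x\<in>#M. reg x))"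
  have "log_expansion (\<lambda>z. 1 / real (Suc n) * (Li [E1] z * Li v z + (- 1) * (\<Sum>x\<in>#M. Li x z))) ?P"
    by (intro log_expansion_cmult log_expansion_add log_expansion_mult log_expansion_Li_E1 step(2)
        log_expansion_sum_mset) (use step(4) in auto)
  then have "log_expansion (Li w) ?P"
  proof (rule log_expansion_cong)
    fix z :: real assume z: "0 < z" "z < 1"
    have "Li [E1] z * Li v z = real (Suc n) * Li w z + (\<Sum>x\<in>#M. Li x z)"
      using Li_shuffle[OF _ step(1) z, of "[E1]"] unfolding step(5)
      by (simp add: sum_mset_replicate_mset algebra_simps)
    then show "1 / real (Suc n) * (Li [E1] z * Li v z + (- 1) * (\<Sum>x\<in>#M. Li x z)) = Li w z"
      by (simp del: of_nat_Suc)
  qed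
  then show ?case using reg_eqI by metis
qed

lemma reg_shuffle:
  assumes "e1_word u" "e1_word v"
  shows "reg u * reg v = (\<Sum>w\<in>#shuffle_words u v. reg w)"
proof (rule log_expansion_unique)
  show "log_expansion (\<lambda>z. Li u z * Li v z) (reg u * reg v)"
    by (intro log_expansion_mult log_expansion_reg assms)
  have "log_expansion (\<lambda>z. \<Sum>w\<in>#shuffle_words u v. Li w z) (\<Sum>w\<in>#shuffle_words u v. reg w)"
    using shuffle_words_e1_word[OF assms] by (intro log_expansion_sum_mset log_expansion_reg) blast
  then show "log_expansion (\<lambda>z. Li u z * Li v z) (\<Sum>w\<in>#shuffle_words u v. reg w)"
    by (rule log_expansion_cong) (simp add: Li_shuffle[OF assms])
qed

lemma reg_admissible:
  assumes "e1_word w" "w = [] \<or> last w = E0"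
  shows "reg w = [:suminf (fps_nth (polylog w)):]"
  using log_expansion_admissible[OF assms] by (rule reg_eqI)

lemma reg_E1: "reg [E1] = [:0, 1:]"
  using log_expansion_Li_E1 by (rule reg_eqI)

text \<open>The \<open>n\<close>-th shuffle power of \<open>e\<^sub>1\<close> is \<open>n!\<close> times the word \<open>e\<^sub>1\<^sup>n\<close>.\<close>

lemma reg_replicate_E1: "reg (replicate n E1) = monom (1 / fact n) n"
proof (induction n)
  case 0
  have "suminf (fps_nth (polylog [])) = 1"
    by (subst suminf_finite[of "{0}"]) auto
  then show ?case using reg_admissible[of "[]"] by (simp add: monom_0)
next
  case (Suc n)
  have "[:0, 1:] * reg (replicate n E1) = of_nat (Suc n) * reg (replicate (Suc n) E1)"
    using reg_shuffle[of "[E1]" "replicate n E1"] shuffle_E1_append_E1s[of "[]" n]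
    by (cases n) (simp_all add: reg_E1 sum_mset_replicate_mset algebra_simps)
  then have "monom (1 / fact n) (Suc n) = smult (real (Suc n)) (reg (replicate (Suc n) E1))"
    unfolding Suc by (simp add: monom_Suc of_nat_poly del: of_nat_Suc replicate_Suc)
  then have "smult (1 / real (Suc n)) (monom (1 / fact n) (Suc n)) = reg (replicate (Suc n) E1)"
    by (simp del: of_nat_Suc replicate_Suc)
  then show ?case by (simp add: smult_monom)
qed

section \<open>The regularized shuffle homomorphism\<close>

definition reg_poly :: "ncpoly \<Rightarrow> real poly" where
  "reg_poly f = (\<Sum>w\<in>Poly_Mapping.keys f. smult (of_rat (Poly_Mapping.lookup f w)) (reg w))"

lemma reg_poly_superset:
  assumes "finite A" "Poly_Mapping.keys f \<subseteq> A"
  shows "reg_poly f = (\<Sum>w\<in>A. smult (of_rat (Poly_Mapping.lookup f w)) (reg w))"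
  unfolding reg_poly_def using assms
  by (intro sum.mono_neutral_left) (auto simp: in_keys_iff)

lemma reg_poly_0 [simp]: "reg_poly 0 = 0"
  by (simp add: reg_poly_def)

lemma reg_poly_add: "reg_poly (f + g) = reg_poly f + reg_poly g"
proof -
  let ?A = "Poly_Mapping.keys f \<union> Poly_Mapping.keys g"
  have "Poly_Mapping.keys (f + g) \<subseteq> ?A" by (rule Poly_Mapping.keys_add)
  then show ?thesis
    using reg_poly_superset[of ?A f] reg_poly_superset[of ?A g] reg_poly_superset[of ?A "f + g"]
    by (simp add: lookup_add of_rat_add smult_add_left sum.distrib)
qed

lemma reg_poly_single: "reg_poly (Poly_Mapping.single w c) = smult (of_rat c) (reg w)"
  by (cases "c = 0") (auto simp: reg_poly_def)

lemma reg_poly_sum: "reg_poly (\<Sum>i\<in>I. f i) = (\<Sum>i\<in>I. reg_poly (f i))"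
  by (induction I rule: infinite_finite_induct) (auto simp: reg_poly_add)

lemma reg_poly_sum_mset: "reg_poly (\<Sum>i\<in>#M. f i) = (\<Sum>i\<in>#M. reg_poly (f i))"
  by (induction M) (auto simp: reg_poly_add)

lemma lookup_ncscale: "Poly_Mapping.lookup (ncscale c f) w = c * Poly_Mapping.lookup f w"
  by (simp add: ncscale_def Poly_Mapping.map.rep_eq when_def)

lemma keys_ncscale: "Poly_Mapping.keys (ncscale c f) \<subseteq> Poly_Mapping.keys f"
  by (auto simp: in_keys_iff lookup_ncscale)

lemma smult_sum_right: "smult c (\<Sum>i\<in>I. p i) = (\<Sum>i\<in>I. smult c (p i))"
  by (induction I rule: infinite_finite_induct) (auto simp: smult_add_right)

lemma reg_poly_ncscale: "reg_poly (ncscale c f) = smult (of_rat c) (reg_poly f)"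
  using reg_poly_superset[OF finite_keys keys_ncscale]
  by (simp add: reg_poly_def lookup_ncscale of_rat_mult smult_sum_right)

lemma sum_mset_smult: "(\<Sum>i\<in>#M. smult c (p i)) = smult c (\<Sum>i\<in>#M. p i)"
  by (induction M) (auto simp: smult_add_right)

lemma reg_poly_shuffle:
  assumes "f \<in> h1" "g \<in> h1"
  shows "reg_poly (shuffle_prod f g) = reg_poly f * reg_poly g"
proof -
  let ?f = "Poly_Mapping.lookup f" and ?g = "Poly_Mapping.lookup g"
  have "reg_poly (shuffle_prod f g) = (\<Sum>u\<in>Poly_Mapping.keys f. \<Sum>v\<in>Poly_Mapping.keys g.
      smult (of_rat (?f u * ?g v)) (\<Sum>w\<in>#shuffle_words u v. reg w))"
    by (simp add: shuffle_prod_def reg_poly_sum reg_poly_sum_mset reg_poly_single sum_mset_smult)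
  also have "\<dots> = (\<Sum>u\<in>Poly_Mapping.keys f. \<Sum>v\<in>Poly_Mapping.keys g.
      smult (of_rat (?f u)) (reg u) * smult (of_rat (?g v)) (reg v))"
  proof (intro sum.cong refl)
    fix u v assume "u \<in> Poly_Mapping.keys f" "v \<in> Poly_Mapping.keys g"
    then have "e1_word u" "e1_word v" using assms by (auto simp: h1_def)
    then show "smult (of_rat (?f u * ?g v)) (\<Sum>w\<in>#shuffle_words u v. reg w) =
        smult (of_rat (?f u)) (reg u) * smult (of_rat (?g v)) (reg v)"
      by (simp add: reg_shuffle[symmetric] of_rat_mult mult.commute)
  qed
  also have "\<dots> = reg_poly f * reg_poly g"
    by (simp add: reg_poly_def sum_product)
  finally show ?thesis .
qed

lemma reg_poly_h0:
  assumes "f \<in> h0"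
  shows "reg_poly f = [:Z f:]"
proof -
  have "reg_poly f = (\<Sum>w\<in>Poly_Mapping.keys f.
      [:of_rat (Poly_Mapping.lookup f w) * mzv (word_index w):])"
    unfolding reg_poly_def
  proof (intro sum.cong refl)
    fix w assume "w \<in> Poly_Mapping.keys f"
    then have "e1_word w" "w = [] \<or> last w = E0" using assms by (auto simp: h0_def)
    then show "smult (of_rat (Poly_Mapping.lookup f w)) (reg w) =
        [:of_rat (Poly_Mapping.lookup f w) * mzv (word_index w):]"
      by (simp add: reg_admissible mzv_word_index)
  qed
  also have "(\<Sum>w\<in>A. [:c w:]) = [:\<Sum>w\<in>A. c w:]" for A and c :: "letter list \<Rightarrow> real"
    by (induction A rule: infinite_finite_induct) auto
  finally show ?thesis by (simp add: Z_def)
qed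

lemma of_word_in_h1 [simp]: "of_word w \<in> h1 \<longleftrightarrow> e1_word w"
  by (simp add: h1_def)

lemma h1_0: "0 \<in> h1"
  by (simp add: h1_def)

lemma h1_add: "f \<in> h1 \<Longrightarrow> g \<in> h1 \<Longrightarrow> f + g \<in> h1"
  unfolding h1_def using Poly_Mapping.keys_add[of f g] by blast

lemma h1_sum: "(\<And>i. i \<in> I \<Longrightarrow> f i \<in> h1) \<Longrightarrow> (\<Sum>i\<in>I. f i) \<in> h1"
  by (induction I rule: infinite_finite_induct) (auto simp: h1_0 h1_add)

lemma h1_sum_mset: "(\<And>i. i \<in># M \<Longrightarrow> f i \<in> h1) \<Longrightarrow> (\<Sum>i\<in>#M. f i) \<in> h1"
  by (induction M) (auto simp: h1_0 h1_add)

lemma h1_ncscale: "f \<in> h1 \<Longrightarrow> ncscale c f \<in> h1"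
  unfolding h1_def using keys_ncscale[of c f] by blast

lemma h1_shuffle_prod:
  assumes "f \<in> h1" "g \<in> h1"
  shows "shuffle_prod f g \<in> h1"
  unfolding shuffle_prod_def
proof (rule h1_sum, rule h1_sum, rule h1_sum_mset)
  fix u v w
  assume "u \<in> Poly_Mapping.keys f" "v \<in> Poly_Mapping.keys g" and w: "w \<in># shuffle_words u v"
  then have "e1_word u" "e1_word v" using assms by (simp_all add: h1_def)
  from shuffle_words_e1_word[OF this w]
  show "Poly_Mapping.single w (Poly_Mapping.lookup f u * Poly_Mapping.lookup g v) \<in> h1"
    by (simp add: h1_def)
qed

lemma shuffle_prod_of_word: "shuffle_prod (of_word u) (of_word v) = (\<Sum>w\<in>#shuffle_words u v. of_word w)"
  by (simp add: shuffle_prod_def)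

lemma ncpoly_expand: "f = (\<Sum>w\<in>Poly_Mapping.keys f. ncscale (Poly_Mapping.lookup f w) (of_word w))"
proof (rule poly_mapping_eqI)
  fix x
  show "Poly_Mapping.lookup f x =
      Poly_Mapping.lookup (\<Sum>w\<in>Poly_Mapping.keys f. ncscale (Poly_Mapping.lookup f w) (of_word w)) x"
    by (simp add: lookup_sum lookup_ncscale lookup_single when_def in_keys_iff
        if_distrib[of "(*) _"] cong: if_cong)
qed

text \<open>Any homomorphism with the prescribed values agrees with \<^term>\<open>reg\<close> on words by induction on trailing
  letters \<^term>\<open>E1\<close>, since \<^term>\<open>reg\<close> satisfies the same relations in characteristic 0.\<close>

lemma reg_poly_unique:
  assumes add: "\<forall>f\<in>h1. \<forall>g\<in>h1. \<phi> (f + g) = \<phi> f + \<phi> g"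
    and scale: "\<forall>c. \<forall>f\<in>h1. \<phi> (ncscale c f) = smult (of_rat c) (\<phi> f)"
    and shuffle: "\<forall>f\<in>h1. \<forall>g\<in>h1. \<phi> (shuffle_prod f g) = \<phi> f * \<phi> g"
    and h0: "\<forall>f\<in>h0. \<phi> f = [:Z f:]"
    and E1: "\<phi> (of_word [E1]) = [:0, 1:]"
    and f: "f \<in> h1"
  shows "\<phi> f = reg_poly f"
proof -
  have \<phi>0: "\<phi> 0 = 0" using add h1_0 by force
  have \<phi>_sum_mset: "\<phi> (\<Sum>i\<in>#M. g i) = (\<Sum>i\<in>#M. \<phi> (g i))" if "\<And>i. i \<in># M \<Longrightarrow> g i \<in> h1"
    for M and g :: "letter list \<Rightarrow> ncpoly"
    using that by (induction M) (auto simp: \<phi>0 add h1_sum_mset)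
  have \<phi>_sum: "\<phi> (\<Sum>i\<in>I. g i) = (\<Sum>i\<in>I. \<phi> (g i))" if "\<And>i. i \<in> I \<Longrightarrow> g i \<in> h1"
    for I and g :: "letter list \<Rightarrow> ncpoly"
    using that by (induction I rule: infinite_finite_induct) (auto simp: \<phi>0 add h1_sum)
  have word: "\<phi> (of_word w) = reg w" if "e1_word w" for w
    using that
  proof (induct rule: e1_word_induct)
    case (admissible v)
    then have "of_word v \<in> h0" by (auto simp: h0_def)
    then have "\<phi> (of_word v) = reg_poly (of_word v)" using h0 reg_poly_h0 by simp
    then show ?case by (simp add: reg_poly_single)
  next
    case (step v w n M)
    have sh: "e1_word x" if "x \<in># shuffle_words [E1] v" for x
      using shuffle_words_e1_word[OF _ step(1) that] by simp
    have "[:0, 1:] * reg v = \<phi> (shuffle_prod (of_word [E1]) (of_word v))"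
      using shuffle step(1,2) by (simp add: E1)
    also have "\<dots> = (\<Sum>x\<in>#shuffle_words [E1] v. \<phi> (of_word x))"
      unfolding shuffle_prod_of_word using sh by (intro \<phi>_sum_mset) simp
    also have "\<dots> = of_nat (Suc n) * \<phi> (of_word w) + (\<Sum>x\<in>#M. \<phi> (of_word x))"
      unfolding step(5) by (simp add: sum_mset_replicate_mset distrib_right)
    also have "(\<Sum>x\<in>#M. \<phi> (of_word x)) = (\<Sum>x\<in>#M. reg x)"
      using step(4) by (intro arg_cong[of _ _ sum_mset] image_mset_cong) simp
    finally have "[:0, 1:] * reg v = of_nat (Suc n) * \<phi> (of_word w) + (\<Sum>x\<in>#M. reg x)" .
    moreover have "[:0, 1:] * reg v = of_nat (Suc n) * reg w + (\<Sum>x\<in>#M. reg x)"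
      using reg_shuffle[of "[E1]" v] step(1) unfolding step(5)
      by (simp add: reg_E1 sum_mset_replicate_mset distrib_right)
    ultimately have "of_nat (Suc n) * \<phi> (of_word w) = of_nat (Suc n) * reg w" by simp
    then show ?case using of_nat_neq_0 mult_left_cancel by blast
  qed
  have keys: "of_word w \<in> h1" if "w \<in> Poly_Mapping.keys f" for w
    using that f by (simp add: h1_def)
  have "\<phi> f = \<phi> (\<Sum>w\<in>Poly_Mapping.keys f. ncscale (Poly_Mapping.lookup f w) (of_word w))"
    using ncpoly_expand[of f] by simp
  also have "\<dots> = (\<Sum>w\<in>Poly_Mapping.keys f. \<phi> (ncscale (Poly_Mapping.lookup f w) (of_word w)))"
    by (intro \<phi>_sum h1_ncscale keys)
  also have "\<dots> = reg_poly f"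
    unfolding reg_poly_def
  proof (intro sum.cong refl)
    fix w assume "w \<in> Poly_Mapping.keys f"
    from keys[OF this]
    show "\<phi> (ncscale (Poly_Mapping.lookup f w) (of_word w)) = smult (of_rat (Poly_Mapping.lookup f w)) (reg w)"
      using scale word[of w] by simp
  qed
  finally show ?thesis .
qed

lemma Z_sh_eq_reg_poly:
  assumes "f \<in> h1"
  shows "Z_sh f = reg_poly f"
proof -
  have "Z_sh = restrict reg_poly h1"
    unfolding Z_sh_def
  proof (rule the_equality, intro conjI)
    show "\<forall>f\<in>h1. \<forall>g\<in>h1. restrict reg_poly h1 (shuffle_prod f g) =
        restrict reg_poly h1 f * restrict reg_poly h1 g"
      by (simp add: reg_poly_shuffle h1_shuffle_prod)
    have "h0 \<subseteq> h1" by (auto simp: h0_def h1_def)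
    then show "\<forall>f\<in>h0. restrict reg_poly h1 f = [:Z f:]"
      by (auto simp: reg_poly_h0)
  next
    fix \<phi> assume \<phi>: "\<phi> \<in> extensional h1 \<and>
     (\<forall>f\<in>h1. \<forall>g\<in>h1. \<phi> (f + g) = \<phi> f + \<phi> g) \<and>
     (\<forall>c. \<forall>f\<in>h1. \<phi> (ncscale c f) = smult (of_rat c) (\<phi> f)) \<and>
     (\<forall>f\<in>h1. \<forall>g\<in>h1. \<phi> (shuffle_prod f g) = \<phi> f * \<phi> g) \<and>
     (\<forall>f\<in>h0. \<phi> f = [:Z f:]) \<and>
     \<phi> (of_word [E1]) = [:0, 1:]"
    show "\<phi> = restrict reg_poly h1"
    proof (rule extensionalityI)
      show "\<phi> f = restrict reg_poly h1 f" if "f \<in> h1" for f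
        using \<phi> that reg_poly_unique[of \<phi> f] by simp
    qed (use \<phi> in auto)
  qed (auto simp: h1_add h1_ncscale reg_poly_add reg_poly_ncscale reg_poly_single reg_E1)
  then have "Z_sh f = restrict reg_poly h1 f" by (rule fun_cong)
  also have "\<dots> = reg_poly f" using assms by (rule restrict_apply')
  finally show ?thesis .
qed

section \<open>Linear extensions\<close>

lemma linear_extensionsD:
  assumes "xs \<in> linear_extensions X R"
  shows "distinct xs" "set xs = X"
  using assms unfolding linear_extensions_def by blast+

lemma linear_extensions_iff:
  assumes "irrefl R"
  shows "linear_extensions X R =
    {xs. distinct xs \<and> set xs = X \<and> sorted_wrt (\<lambda>x y. (y, x) \<notin> R) xs}"
proof -
  have "(\<forall>p<length xs. \<forall>q<length xs. (xs ! p, xs ! q) \<in> R \<longrightarrow> p < q) \<longleftrightarrow>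
        sorted_wrt (\<lambda>x y. (y, x) \<notin> R) xs" for xs
  proof
    assume *: "\<forall>p<length xs. \<forall>q<length xs. (xs ! p, xs ! q) \<in> R \<longrightarrow> p < q"
    show "sorted_wrt (\<lambda>x y. (y, x) \<notin> R) xs"
      unfolding sorted_wrt_iff_nth_less using * by (meson less_trans not_less_iff_gr_or_eq)
  next
    assume *: "sorted_wrt (\<lambda>x y. (y, x) \<notin> R) xs"
    show "\<forall>p<length xs. \<forall>q<length xs. (xs ! p, xs ! q) \<in> R \<longrightarrow> p < q"
    proof (intro allI impI)
      fix p q assume pq: "p < length xs" "q < length xs" "(xs ! p, xs ! q) \<in> R"
      have "p \<noteq> q" using pq(3) assms by (auto simp: irrefl_def)
      moreover have "\<not> q < p" using * pq by (auto simp: sorted_wrt_iff_nth_less)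
      ultimately show "p < q" by simp
    qed
  qed
  then show ?thesis by (simp add: linear_extensions_def)
qed

text \<open>Increasing positions are preserved by composing relations, so generators of the order suffice.\<close>

lemma linear_extensions_trancl:
  assumes "Field R \<subseteq> X"
  shows "linear_extensions X (R\<^sup>+) = linear_extensions X R"
proof (intro equalityI subsetI)
  fix xs assume "xs \<in> linear_extensions X R"
  then have xs: "distinct xs" "set xs = X"
      "\<And>p q. \<lbrakk>p < length xs; q < length xs; (xs ! p, xs ! q) \<in> R\<rbrakk> \<Longrightarrow> p < q"
    by (auto simp: linear_extensions_def)
  have "\<exists>p q. p < q \<and> q < length xs \<and> xs ! p = a \<and> xs ! q = b" if "(a, b) \<in> R\<^sup>+" for a b
    using that
  proof (induction rule: trancl_induct)
    case (base b)
    then have "a \<in> set xs" "b \<in> set xs" using assms xs(2) by (auto simp: Field_def)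
    then show ?case using xs(3) base by (metis in_set_conv_nth)
  next
    case (step b c)
    then have "c \<in> set xs" using assms xs(2) by (auto simp: Field_def)
    then obtain r where r: "r < length xs" "xs ! r = c" by (auto simp: in_set_conv_nth)
    obtain p q where pq: "p < q" "q < length xs" "xs ! p = a" "xs ! q = b" using step by auto
    have "q < r" using xs(3)[of q r] pq r step by auto
    then show ?case using pq r by (metis less_trans)
  qed
  then show "xs \<in> linear_extensions X (R\<^sup>+)"
    using xs(1,2) unfolding linear_extensions_def
    by (auto) (metis less_trans nth_eq_iff_index_eq)
qed (auto simp: linear_extensions_def)

lemma linear_extensions_cong:
  assumes "\<And>x y. x \<in> X \<Longrightarrow> y \<in> X \<Longrightarrow> (x, y) \<in> R \<longleftrightarrow> (x, y) \<in> R'"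
  shows "linear_extensions X R = linear_extensions X R'"
proof -
  have "(xs ! p, xs ! q) \<in> R \<longleftrightarrow> (xs ! p, xs ! q) \<in> R'"
    if "set xs = X" "p < length xs" "q < length xs" for xs p q
    using assms that by (metis nth_mem)
  then show ?thesis unfolding linear_extensions_def by blast
qed

text \<open>The first element of a linear extension has no predecessor, so if every element other than \<open>z\<close> has
  one, then \<open>z\<close> comes first.\<close>

lemma linear_extensions_insert_min:
  assumes "irrefl R" "z \<notin> X"
    and "\<And>x. x \<in> X \<Longrightarrow> (x, z) \<notin> R"
    and "\<And>x. x \<in> X \<Longrightarrow> \<exists>w\<in>insert z X. (w, x) \<in> R"
  shows "linear_extensions (insert z X) R = (#) z ` linear_extensions X R"
proof (intro equalityI subsetI)
  fix xs assume "xs \<in> linear_extensions (insert z X) R"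
  then have xs: "distinct xs" "set xs = insert z X" "sorted_wrt (\<lambda>x y. (y, x) \<notin> R) xs"
    by (auto simp: linear_extensions_iff[OF assms(1)])
  then obtain y ys where ys: "xs = y # ys" by (cases xs) auto
  have "y = z"
  proof (rule ccontr)
    assume "y \<noteq> z"
    then have "y \<in> X" using xs(2) ys by auto
    then obtain w where w: "w \<in> insert z X" "(w, y) \<in> R" using assms(4) by blast
    then have "w \<in> set xs" using xs(2) by simp
    then show False using w(2) xs(3) assms(1) ys by (auto simp: irrefl_def)
  qed
  then have "z \<notin> set ys" "insert z (set ys) = insert z X" using xs(1,2) ys by auto
  then have "set ys = X" using assms(2) by (metis insert_ident)
  then have "ys \<in> linear_extensions X R"
    using xs(1,3) ys unfolding linear_extensions_iff[OF assms(1)] by simp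
  then show "xs \<in> (#) z ` linear_extensions X R"
    using ys \<open>y = z\<close> by blast
next
  fix xs assume "xs \<in> (#) z ` linear_extensions X R"
  then obtain ys where xs: "xs = z # ys" and "ys \<in> linear_extensions X R"
    by (rule imageE)
  then have ys: "distinct ys" "set ys = X" "sorted_wrt (\<lambda>x y. (y, x) \<notin> R) ys"
    unfolding linear_extensions_iff[OF assms(1)] by simp_all
  have "\<forall>x\<in>set ys. (x, z) \<notin> R" using assms(3) ys(2) by blast
  then show "xs \<in> linear_extensions (insert z X) R"
    unfolding linear_extensions_iff[OF assms(1)] xs using ys assms(2) by simp
qed

lemma linear_extensions_chain:
  assumes "irrefl R" "distinct L" "successively (\<lambda>x y. (x, y) \<in> R) L"
    and "sorted_wrt (\<lambda>x y. (y, x) \<notin> R) L"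
  shows "linear_extensions (set L) R = {L}"
  using assms(2-)
proof (induction L)
  case Nil
  then show ?case by (auto simp: linear_extensions_def)
next
  case (Cons z L)
  have pred: "\<exists>w\<in>set (z # L). (w, x) \<in> R" if "successively (\<lambda>x y. (x, y) \<in> R) (z # L)" "x \<in> set L"
    for x z L using that
  proof (induction L arbitrary: z)
    case (Cons y L)
    then show ?case by (cases "x = y") force+
  qed simp
  have "linear_extensions (insert z (set L)) R = (#) z ` linear_extensions (set L) R"
    using Cons.prems pred[OF Cons.prems(2)]
    by (intro linear_extensions_insert_min[OF assms(1)]) auto
  moreover have "successively (\<lambda>x y. (x, y) \<in> R) L"
    using Cons.prems(2) by (cases L) auto
  ultimately show ?case using Cons.IH Cons.prems(1,3) by simp
qed

lemma finite_linear_extensions: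
  assumes "finite X"
  shows "finite (linear_extensions X R)"
proof (rule finite_subset)
  show "linear_extensions X R \<subseteq> {xs. set xs \<subseteq> X \<and> length xs = card X}"
    using linear_extensionsD distinct_card by fastforce
  show "finite {xs. set xs \<subseteq> X \<and> length xs = card X}"
    using assms by (rule finite_lists_length_eq)
qed

lemma mset_set_shuffles:
  assumes "set xs \<inter> set ys = {}" "distinct xs" "distinct ys"
  shows "mset_set (shuffles xs ys) = shuffle_words xs ys"
  using assms
proof (induction xs ys rule: shuffle_words.induct)
  case (3 a u b v)
  have "mset_set (shuffles (a # u) (b # v)) =
     mset_set ((#) a ` shuffles u (b # v)) + mset_set ((#) b ` shuffles (a # u) v)"
    using 3(3) by (auto intro!: mset_set_Union)
  also have "\<dots> = image_mset ((#) a) (mset_set (shuffles u (b # v))) +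
      image_mset ((#) b) (mset_set (shuffles (a # u) v))"
    by (simp add: image_mset_mset_set)
  finally show ?case using 3 by simp
qed auto

text \<open>A linear extension of a union of two unrelated parts is a shuffle of linear extensions of the
  parts, which are recovered from it by filtering.\<close>

lemma sum_linear_extensions_disjoint_union:
  fixes g :: "'a list \<Rightarrow> 'b :: comm_monoid_add"
  assumes "irrefl R" "X \<inter> Y = {}" "finite X" "finite Y"
    and "\<And>x y. x \<in> X \<Longrightarrow> y \<in> Y \<Longrightarrow> (x, y) \<notin> R \<and> (y, x) \<notin> R"
  shows "(\<Sum>zs\<in>linear_extensions (X \<union> Y) R. g zs) =
    (\<Sum>xs\<in>linear_extensions X R. \<Sum>ys\<in>linear_extensions Y R. \<Sum>zs\<in>#shuffle_words xs ys. g zs)"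
proof -
  let ?L = "\<lambda>X. linear_extensions X R"
  have fin: "finite (?L X)" if "finite X" for X
    using that by (rule finite_linear_extensions)
  have eq: "?L (X \<union> Y) = (\<Union>(xs, ys)\<in>?L X \<times> ?L Y. shuffles xs ys)"
  proof (intro equalityI subsetI)
    fix zs assume zs: "zs \<in> ?L (X \<union> Y)"
    let ?xs = "filter (\<lambda>z. z \<in> X) zs" and ?ys = "filter (\<lambda>z. z \<notin> X) zs"
    have "?xs \<in> ?L X" "?ys \<in> ?L Y"
      using zs assms(2) by (auto simp: linear_extensions_iff[OF assms(1)] sorted_wrt_filter)
    moreover have "zs \<in> shuffles ?xs ?ys" by (rule partition_in_shuffles)
    ultimately show "zs \<in> (\<Union>(xs, ys)\<in>?L X \<times> ?L Y. shuffles xs ys)" by blast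
  next
    fix zs assume "zs \<in> (\<Union>(xs, ys)\<in>?L X \<times> ?L Y. shuffles xs ys)"
    then obtain xs ys where *: "xs \<in> ?L X" "ys \<in> ?L Y" "zs \<in> shuffles xs ys" by auto
    have "sorted_wrt (\<lambda>x y. (y, x) \<notin> R) zs"
      if "sorted_wrt (\<lambda>x y. (y, x) \<notin> R) xs" "sorted_wrt (\<lambda>x y. (y, x) \<notin> R) ys"
         "set xs \<subseteq> X" "set ys \<subseteq> Y"
      using that *(3)
    proof (induction xs ys arbitrary: zs rule: shuffles.induct)
      case (3 x xs y ys)
      from 3(7) consider zs' where "zs = x # zs'" "zs' \<in> shuffles xs (y # ys)"
        | zs' where "zs = y # zs'" "zs' \<in> shuffles (x # xs) ys"
        by (auto simp: image_iff)
      then show ?case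
      proof cases
        case 1
        then have "sorted_wrt (\<lambda>x y. (y, x) \<notin> R) zs'" using 3(1) 3(3-6) by simp
        moreover have "(z, x) \<notin> R" if "z \<in> set zs'" for z
          using that 3(3) 3(5,6) assms(5)[of x z] unfolding set_shuffles[OF 1(2)] by auto
        ultimately show ?thesis using 1(1) by simp
      next
        case 2
        then have "sorted_wrt (\<lambda>x y. (y, x) \<notin> R) zs'" using 3(2) 3(3-6) by simp
        moreover have "(z, y) \<notin> R" if "z \<in> set zs'" for z
          using that 3(4) 3(5,6) assms(5)[of z y] unfolding set_shuffles[OF 2(2)] by auto
        ultimately show ?thesis using 2(1) by simp
      qed
    qed auto
    then show "zs \<in> ?L (X \<union> Y)"
      using * assms(2) distinct_disjoint_shuffles[of xs ys zs] set_shuffles[OF *(3)]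
      by (auto simp: linear_extensions_iff[OF assms(1)])
  qed
  have disj: "shuffles xs ys \<inter> shuffles xs' ys' = {}"
    if "xs \<in> ?L X" "ys \<in> ?L Y" "xs' \<in> ?L X" "ys' \<in> ?L Y" "(xs, ys) \<noteq> (xs', ys')"
    for xs ys xs' ys'
  proof (rule ccontr)
    assume "shuffles xs ys \<inter> shuffles xs' ys' \<noteq> {}"
    then obtain zs where zs: "zs \<in> shuffles xs ys" "zs \<in> shuffles xs' ys'" by auto
    have d: "set xs \<inter> set ys = {}" "set xs' \<inter> set ys' = {}" "set xs = set xs'" "set ys = set ys'"
    proof -
      have "set xs = X" "set ys = Y" "set xs' = X" "set ys' = Y"
        using that(1-4) linear_extensionsD(2) by blast+
      then show "set xs \<inter> set ys = {}" "set xs' \<inter> set ys' = {}" "set xs = set xs'" "set ys = set ys'"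
        using assms(2) by simp_all
    qed
    have "xs = xs'" using filter_shuffles_disjoint1(1)[OF d(1) zs(1)]
        filter_shuffles_disjoint1(1)[OF d(2) zs(2)] unfolding d(3) by metis
    moreover have "ys = ys'" using filter_shuffles_disjoint1(2)[OF d(1) zs(1)]
        filter_shuffles_disjoint1(2)[OF d(2) zs(2)] unfolding d(3) by metis
    ultimately show False using that(5) by simp
  qed
  have "(\<Sum>zs\<in>?L (X \<union> Y). g zs) = (\<Sum>(xs, ys)\<in>?L X \<times> ?L Y. \<Sum>zs\<in>shuffles xs ys. g zs)"
  proof -
    have "(\<Sum>zs\<in>(\<Union>(xs, ys)\<in>?L X \<times> ?L Y. shuffles xs ys). g zs) =
        (\<Sum>p\<in>?L X \<times> ?L Y. sum g (case p of (xs, ys) \<Rightarrow> shuffles xs ys))"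
    proof (rule sum.UNION_disjoint; (intro ballI impI)?)
      show "finite (?L X \<times> ?L Y)" using fin assms(3,4) by blast
    next
      fix p q assume "p \<in> ?L X \<times> ?L Y" "q \<in> ?L X \<times> ?L Y" "p \<noteq> q"
      then show "(case p of (xs, ys) \<Rightarrow> shuffles xs ys) \<inter> (case q of (xs, ys) \<Rightarrow> shuffles xs ys) = {}"
        using disj[of "fst p" "snd p" "fst q" "snd q"] by (cases p; cases q) simp
    qed (simp add: split_def)
    then show ?thesis unfolding eq by (simp add: split_def)
  qed
  also have "\<dots> = (\<Sum>(xs, ys)\<in>?L X \<times> ?L Y. \<Sum>zs\<in>#shuffle_words xs ys. g zs)"
  proof (intro sum.cong refl, clarify)
    fix xs ys assume "xs \<in> ?L X" "ys \<in> ?L Y"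
    then have "shuffle_words xs ys = mset_set (shuffles xs ys)"
      using assms(2)
      by (intro mset_set_shuffles[symmetric]) (simp_all add: linear_extensionsD)
    then show "sum g (shuffles xs ys) = (\<Sum>zs\<in>#shuffle_words xs ys. g zs)"
      by (simp add: sum_unfold_sum_mset)
  qed
  finally show ?thesis by (simp add: sum.cartesian_product)
qed

section \<open>The posets of the indices with one entry above 1\<close>

lemma linear_extensions_last:
  assumes "irrefl R" "X \<noteq> {}"
  shows "linear_extensions X R =
    (\<Union>m\<in>{m \<in> X. \<forall>x\<in>X. (m, x) \<notin> R}. (\<lambda>xs. xs @ [m]) ` linear_extensions (X - {m}) R)"
proof (intro equalityI subsetI)
  fix zs assume zs: "zs \<in> linear_extensions X R"
  then obtain xs m where m: "zs = xs @ [m]"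
    using assms(2) by (cases zs rule: rev_cases) (auto dest: linear_extensionsD)
  have zs': "distinct xs" "m \<notin> set xs" "insert m (set xs) = X" "sorted_wrt (\<lambda>x y. (y, x) \<notin> R) xs"
      "\<forall>x\<in>set xs. (m, x) \<notin> R"
    using zs unfolding m linear_extensions_iff[OF assms(1)] by (simp_all add: sorted_wrt_append)
  have "set xs = X - {m}" using zs'(2,3) by blast
  then have "xs \<in> linear_extensions (X - {m}) R"
    unfolding linear_extensions_iff[OF assms(1)] using zs'(1,4) by simp
  moreover have "\<forall>x\<in>X. (m, x) \<notin> R"
    using zs'(3,5) assms(1) by (metis insertE irrefl_def)
  moreover have "m \<in> X" using zs'(3) by blast
  ultimately show "zs \<in> (\<Union>m\<in>{m \<in> X. \<forall>x\<in>X. (m, x) \<notin> R}.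
      (\<lambda>xs. xs @ [m]) ` linear_extensions (X - {m}) R)"
    using m by blast
next
  fix zs assume "zs \<in> (\<Union>m\<in>{m \<in> X. \<forall>x\<in>X. (m, x) \<notin> R}.
      (\<lambda>xs. xs @ [m]) ` linear_extensions (X - {m}) R)"
  then obtain m xs where m: "m \<in> X" "\<And>x. x \<in> X \<Longrightarrow> (m, x) \<notin> R" "zs = xs @ [m]"
      "xs \<in> linear_extensions (X - {m}) R"
    by blast
  have xs: "distinct xs" "set xs = X - {m}" "sorted_wrt (\<lambda>x y. (y, x) \<notin> R) xs"
    using m(4) unfolding linear_extensions_iff[OF assms(1)] by simp_all
  have "insert m (X - {m}) = X" using m(1) by blast
  then show "zs \<in> linear_extensions X R"
    unfolding linear_extensions_iff[OF assms(1)] m(3) using xs m(2)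
    by (simp add: sorted_wrt_append)
qed

lemma sum_linear_extensions_last:
  assumes "irrefl R" "X \<noteq> {}" "finite X"
  shows "(\<Sum>zs\<in>linear_extensions X R. g zs) =
    (\<Sum>m\<in>{m \<in> X. \<forall>x\<in>X. (m, x) \<notin> R}. \<Sum>xs\<in>linear_extensions (X - {m}) R. g (xs @ [m]))"
proof -
  have "(\<Sum>zs\<in>linear_extensions X R. g zs) =
      (\<Sum>m\<in>{m \<in> X. \<forall>x\<in>X. (m, x) \<notin> R}. sum g ((\<lambda>xs. xs @ [m]) ` linear_extensions (X - {m}) R))"
    unfolding linear_extensions_last[OF assms(1,2)]
  proof (rule sum.UNION_disjoint)
    show "finite {m \<in> X. \<forall>x\<in>X. (m, x) \<notin> R}" using assms(3) by simp
    show "\<forall>m\<in>{m \<in> X. \<forall>x\<in>X. (m, x) \<notin> R}. finite ((\<lambda>xs. xs @ [m]) ` linear_extensions (X - {m}) R)"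
      using finite_linear_extensions assms(3) by blast
  qed blast
  also have "\<dots> = (\<Sum>m\<in>{m \<in> X. \<forall>x\<in>X. (m, x) \<notin> R}.
      \<Sum>xs\<in>linear_extensions (X - {m}) R. g (xs @ [m]))"
    by (rule sum.cong[OF refl], subst sum.reindex) (simp_all add: inj_on_def)
  finally show ?thesis .
qed

text \<open>The elements \<open>(i, 1)\<close> with \<open>i \<le> a\<close> form a chain below the top \<open>(a + 1, k)\<close> of the column of the entry
  \<open>k\<close>, and those with \<open>i > a + 1\<close> form a chain above its bottom \<open>(a + 1, 1)\<close>.\<close>

definition hook :: "nat \<Rightarrow> nat \<Rightarrow> nat \<Rightarrow> (nat \<times> nat) set" where
  "hook a k b = X_carrier (replicate a 1 @ [k] @ replicate b 1)"

text \<open>The generating relation of the order, without a bound on the length of the last chain: then the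
  same relation serves for all \<open>b\<close>, and the recursion on \<open>b\<close> changes only the carrier.\<close>

definition hook_rel :: "nat \<Rightarrow> nat \<Rightarrow> ((nat \<times> nat) \<times> (nat \<times> nat)) set" where
  "hook_rel a k = {((i, j), (i', j')).
     i = a + 1 \<and> i' = a + 1 \<and> 1 \<le> j \<and> j < k \<and> j' = j + 1 \<or>
     1 \<le> i \<and> j = 1 \<and> i' = i + 1 \<and> j' = (if i = a then k else 1)}"

lemma hook_rel_iff:
  "((i, j), (i', j')) \<in> hook_rel a k \<longleftrightarrow>
     i = a + 1 \<and> i' = a + 1 \<and> 1 \<le> j \<and> j < k \<and> j' = j + 1 \<or>
     1 \<le> i \<and> j = 1 \<and> i' = i + 1 \<and> j' = (if i = a then k else 1)"
  by (simp add: hook_rel_def)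

lemma irrefl_hook_rel: "irrefl (hook_rel a k)"
  by (auto simp: irrefl_def hook_rel_def)

lemma nth_hook_index:
  "n < a + b + 1 \<Longrightarrow> (replicate a 1 @ [k] @ replicate b 1) ! n = (if n = a then k else 1)"
  by (auto simp: nth_append nth_Cons')

lemma hook_iff:
  assumes "k \<ge> 2"
  shows "(i, j) \<in> hook a k b \<longleftrightarrow> i = a + 1 \<and> 1 \<le> j \<and> j \<le> k \<or> j = 1 \<and> 1 \<le> i \<and> i \<le> a + b + 1"
proof -
  have "(i, j) \<in> hook a k b \<longleftrightarrow> 1 \<le> i \<and> i \<le> a + b + 1 \<and> 1 \<le> j \<and>
      j \<le> (if i - 1 = a then k else 1)"
    unfolding hook_def X_carrier_def using nth_hook_index[of "i - 1" a b k] by (cases i) auto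
  then show ?thesis using assms by auto
qed

lemma finite_hook:
  assumes "k \<ge> 2"
  shows "finite (hook a k b)"
proof (rule finite_subset)
  show "hook a k b \<subseteq> {1..a + b + 1} \<times> {1..k}"
    using assms by (auto simp: hook_iff)
qed simp

lemma linear_extensions_hook:
  assumes "k \<ge> 2"
  shows "linear_extensions (hook a k b) (X_less (replicate a 1 @ [k] @ replicate b 1)) =
    linear_extensions (hook a k b) (hook_rel a k)"
proof -
  let ?ks = "replicate a 1 @ [k] @ replicate b 1"
  define \<kappa> where "\<kappa> n = ?ks ! n" for n
  have \<kappa>: "\<kappa> n = (if n = a then k else 1)" if "n < a + b + 1" for n
    unfolding \<kappa>_def using that by (rule nth_hook_index)
  have mem: "((i, j), (i', j')) \<in> X_generators ?ks \<longleftrightarrow>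
      ((i, j), (i', j')) \<in> hook_rel a k \<and> (i, j) \<in> hook a k b \<and> (i', j') \<in> hook a k b" for i j i' j'
  proof -
    have "((i, j), (i', j')) \<in> X_generators ?ks \<longleftrightarrow>
        i' = i \<and> j' = j + 1 \<and> 1 \<le> i \<and> i \<le> a + b + 1 \<and> 1 \<le> j \<and> j < \<kappa> (i - 1) \<or>
        1 \<le> i \<and> i < a + b + 1 \<and> j = 1 \<and> i' = i + 1 \<and> j' = \<kappa> i"
      unfolding X_generators_def \<kappa>_def by auto
    also have "\<dots> \<longleftrightarrow>
        i' = i \<and> j' = j + 1 \<and> 1 \<le> i \<and> i \<le> a + b + 1 \<and> 1 \<le> j \<and> j < (if i - 1 = a then k else 1) \<or>
        1 \<le> i \<and> i < a + b + 1 \<and> j = 1 \<and> i' = i + 1 \<and> j' = (if i = a then k else 1)"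
      by (simp add: \<kappa> cong: conj_cong)
    also have "\<dots> \<longleftrightarrow> ((i, j), (i', j')) \<in> hook_rel a k \<and> (i, j) \<in> hook a k b \<and> (i', j') \<in> hook a k b"
      using assms by (auto simp: hook_rel_def hook_iff)
    finally show ?thesis .
  qed
  have "Field (X_generators ?ks) \<subseteq> hook a k b"
    using mem by (auto simp: Field_def)
  then have "linear_extensions (hook a k b) (X_less ?ks) =
      linear_extensions (hook a k b) (X_generators ?ks)"
    unfolding X_less_def by (rule linear_extensions_trancl)
  also have "\<dots> = linear_extensions (hook a k b) (hook_rel a k)"
    by (rule linear_extensions_cong) (use mem in auto)
  finally show ?thesis .
qed

text \<open>The sum of \<open>g\<close> over the words of the poset that is left after removing the top of the column: a
  chain of \<open>a\<close> elements beside a root with a chain of \<open>k - 2\<close> and a chain of \<open>b\<close> elements above it.\<close>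

definition hook_core :: "nat \<Rightarrow> nat \<Rightarrow> nat \<Rightarrow> (letter list \<Rightarrow> 'b) \<Rightarrow> 'b :: comm_monoid_add" where
  "hook_core a k b g = (\<Sum>v\<in>#shuffle_words (replicate (k - 2) E0) (replicate b E1).
     \<Sum>w\<in>#shuffle_words (replicate a E1) (E1 # v). g w)"

definition hook_sum :: "nat \<Rightarrow> nat \<Rightarrow> nat \<Rightarrow> (letter list \<Rightarrow> 'b) \<Rightarrow> 'b :: comm_monoid_add" where
  "hook_sum a k b g = (\<Sum>xs\<in>linear_extensions (hook a k b) (hook_rel a k). g (map X_label xs))"

lemma sum_hook_minus_top:
  fixes g :: "letter list \<Rightarrow> 'b :: comm_monoid_add"
  assumes k: "k \<ge> 2"
  shows "(\<Sum>xs\<in>linear_extensions (hook a k b - {(a + 1, k)}) (hook_rel a k). g (map X_label xs)) =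
    hook_core a k b g"
proof -
  let ?R = "hook_rel a k"
  define Y where "Y = map (\<lambda>i. (i, 1 :: nat)) [1..<Suc a]"
  define M where "M = map (\<lambda>j. (a + 1, j)) [2..<k]"
  define U where "U = map (\<lambda>i. (i, 1 :: nat)) [a + 2..<a + 2 + b]"
  define z where "z = (a + 1, 1 :: nat)"
  have sets: "set Y = {(i, j). j = 1 \<and> 1 \<le> i \<and> i \<le> a}"
      "set M = {(i, j). i = a + 1 \<and> 2 \<le> j \<and> j < k}"
      "set U = {(i, j). j = 1 \<and> a + 2 \<le> i \<and> i < a + 2 + b}"
    by (auto simp: Y_def M_def U_def)
  have carrier: "hook a k b - {(a + 1, k)} = set Y \<union> insert z (set M \<union> set U)"
  proof -
    have "(i, j) \<in> hook a k b - {(a + 1, k)} \<longleftrightarrow> (i, j) \<in> set Y \<union> insert z (set M \<union> set U)" for i j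
      using k by (auto simp: hook_iff sets z_def)
    then show ?thesis by auto
  qed
  have Y: "linear_extensions (set Y) ?R = {Y}"
    by (rule linear_extensions_chain[OF irrefl_hook_rel])
       (auto simp: Y_def distinct_map inj_on_def successively_conv_nth sorted_wrt_iff_nth_less
          hook_rel_def simp del: upt_Suc)
  have M: "linear_extensions (set M) ?R = {M}"
    by (rule linear_extensions_chain[OF irrefl_hook_rel])
       (auto simp: M_def distinct_map inj_on_def successively_conv_nth sorted_wrt_iff_nth_less
          hook_rel_def simp del: upt_Suc)
  have U: "linear_extensions (set U) ?R = {U}"
    by (rule linear_extensions_chain[OF irrefl_hook_rel])
       (auto simp: U_def distinct_map inj_on_def successively_conv_nth sorted_wrt_iff_nth_less
          hook_rel_def simp del: upt_Suc)
  have labels: "map X_label Y = replicate a E1" "map X_label M = replicate (k - 2) E0"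
      "map X_label U = replicate b E1" "X_label z = E1"
    by (auto intro!: nth_equalityI simp: Y_def M_def U_def z_def X_label_def simp del: upt_Suc)
  define g' where "g' v = (\<Sum>w\<in>#shuffle_words (replicate a E1) (E1 # v). g w)" for v
  have map_shuffle: "(\<Sum>zs\<in>#shuffle_words us vs. h (map X_label zs)) =
      (\<Sum>w\<in>#shuffle_words (map X_label us) (map X_label vs). h w)"
    for us vs and h :: "letter list \<Rightarrow> 'b"
    by (simp add: multiset.map_comp o_def flip: image_mset_map_shuffle_words)
  have MU: "(\<Sum>zs\<in>linear_extensions (set M \<union> set U) ?R. h (map X_label zs)) =
      (\<Sum>v\<in>#shuffle_words (replicate (k - 2) E0) (replicate b E1). h v)"
    for h :: "letter list \<Rightarrow> 'b"
  proof -
    have "set M \<inter> set U = {}" using sets by auto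
    moreover have "(x, y) \<notin> ?R \<and> (y, x) \<notin> ?R" if "x \<in> set M" "y \<in> set U" for x y
      using that by (cases x rule: prod.exhaust; cases y rule: prod.exhaust) (simp add: sets hook_rel_iff)
    ultimately show ?thesis
      by (subst sum_linear_extensions_disjoint_union[OF irrefl_hook_rel])
         (simp_all add: M U map_shuffle labels)
  qed
  have W: "linear_extensions (insert z (set M \<union> set U)) ?R =
      (#) z ` linear_extensions (set M \<union> set U) ?R"
  proof (rule linear_extensions_insert_min[OF irrefl_hook_rel])
    show "z \<notin> set M \<union> set U" by (auto simp: z_def sets)
    fix x assume x: "x \<in> set M \<union> set U"
    obtain i j where ij: "x = (i, j)" by (cases x)
    show "(x, z) \<notin> ?R" using x by (auto simp: ij z_def sets hook_rel_iff)
    show "\<exists>w\<in>insert z (set M \<union> set U). (w, x) \<in> ?R"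
    proof (cases "x \<in> set M")
      case True
      then have "((a + 1, j - 1), x) \<in> ?R" "(a + 1, j - 1) \<in> insert z (set M \<union> set U)"
        by (auto simp: ij sets z_def hook_rel_iff)
      then show ?thesis by blast
    next
      case False
      then have "((i - 1, 1), x) \<in> ?R" "(i - 1, 1) \<in> insert z (set M \<union> set U)"
        using x by (auto simp: ij sets z_def hook_rel_iff)
      then show ?thesis by blast
    qed
  qed
  have "(\<Sum>xs\<in>linear_extensions (hook a k b - {(a + 1, k)}) ?R. g (map X_label xs)) =
     (\<Sum>ys\<in>linear_extensions (insert z (set M \<union> set U)) ?R. \<Sum>zs\<in>#shuffle_words Y ys. g (map X_label zs))"
  proof -
    have "set Y \<inter> insert z (set M \<union> set U) = {}" by (auto simp: sets z_def)
    moreover have "(x, y) \<notin> ?R \<and> (y, x) \<notin> ?R" if "x \<in> set Y" "y \<in> insert z (set M \<union> set U)" for x y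
      using that k by (cases x rule: prod.exhaust; cases y rule: prod.exhaust) (auto simp: sets z_def hook_rel_iff)
    ultimately show ?thesis
      unfolding carrier
      by (subst sum_linear_extensions_disjoint_union[OF irrefl_hook_rel]) (simp_all add: Y)
  qed
  also have "\<dots> = (\<Sum>ys\<in>linear_extensions (set M \<union> set U) ?R. g' (map X_label ys))"
    unfolding W by (subst sum.reindex) (simp_all add: map_shuffle labels g'_def)
  also have "\<dots> = hook_core a k b g"
    unfolding MU by (simp add: hook_core_def g'_def[abs_def])
  finally show ?thesis .
qed

text \<open>The maximal elements are the top of the column and, for \<open>b > 0\<close>, the end of the last chain.\<close>

lemma hook_sum_rec:
  assumes k: "k \<ge> 2"
  shows "hook_sum a k b g = hook_core a k b (\<lambda>w. g (w @ [E0])) +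
    (if b = 0 then 0 else hook_sum a k (b - 1) (\<lambda>w. g (w @ [E1])))"
proof -
  let ?R = "hook_rel a k"
  have "{m \<in> hook a k b. \<forall>x\<in>hook a k b. (m, x) \<notin> ?R} =
      (if b = 0 then {(a + 1, k)} else {(a + 1, k), (a + b + 1, 1)})" (is "?max = _")
  proof -
    have "(i, j) \<in> ?max \<longleftrightarrow> i = a + 1 \<and> j = k \<or> b > 0 \<and> i = a + b + 1 \<and> j = 1" for i j
    proof
      assume ij: "(i, j) \<in> ?max"
      then have "(i, j) \<in> hook a k b" by simp
      then consider "i = a + 1" "1 \<le> j" "j < k" | "i = a + 1" "j = k" | "j = 1" "1 \<le> i" "i < a + b + 1"
        | "b > 0" "i = a + b + 1" "j = 1"
        using k by (fastforce simp: hook_iff[OF k])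
      then show "i = a + 1 \<and> j = k \<or> b > 0 \<and> i = a + b + 1 \<and> j = 1"
      proof cases
        case 1
        then have "(a + 1, j + 1) \<in> hook a k b" "((i, j), (a + 1, j + 1)) \<in> ?R"
          by (auto simp: hook_iff[OF k] hook_rel_iff)
        then show ?thesis using ij by blast
      next
        case 3
        then have "(i + 1, if i = a then k else 1) \<in> hook a k b"
            "((i, j), (i + 1, if i = a then k else 1)) \<in> ?R"
          using k by (auto simp: hook_iff[OF k] hook_rel_iff)
        then show ?thesis using ij by blast
      qed auto
    next
      assume "i = a + 1 \<and> j = k \<or> b > 0 \<and> i = a + b + 1 \<and> j = 1"
      then show "(i, j) \<in> ?max"
        using k by (auto simp: hook_iff[OF k] hook_rel_iff)
    qed
    then show ?thesis by (auto split: if_splits)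
  qed
  moreover have "hook a k b \<noteq> {}"
    using hook_iff[OF k, of "a + 1" k a b] k by auto
  ultimately have "hook_sum a k b g =
      (\<Sum>m\<in>(if b = 0 then {(a + 1, k)} else {(a + 1, k), (a + b + 1, 1)}).
        \<Sum>xs\<in>linear_extensions (hook a k b - {m}) ?R. g (map X_label xs @ [X_label m]))"
    unfolding hook_sum_def
    by (subst sum_linear_extensions_last[OF irrefl_hook_rel _ finite_hook[OF k]]) simp_all
  also have "\<dots> = (\<Sum>xs\<in>linear_extensions (hook a k b - {(a + 1, k)}) ?R. g (map X_label xs @ [E0])) +
    (if b = 0 then 0 else
      \<Sum>xs\<in>linear_extensions (hook a k b - {(a + b + 1, 1)}) ?R. g (map X_label xs @ [E1]))"
    using k by (auto simp: X_label_def)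
  also have "hook a k b - {(a + b + 1, 1)} = hook a k (b - 1)" if "b > 0"
  proof -
    have "(i, j) \<in> hook a k b - {(a + b + 1, 1)} \<longleftrightarrow> (i, j) \<in> hook a k (b - 1)" for i j
      using k that by (auto simp: hook_iff)
    then show ?thesis by auto
  qed
  then have "(if b = 0 then 0 else
      \<Sum>xs\<in>linear_extensions (hook a k b - {(a + b + 1, 1)}) ?R. g (map X_label xs @ [E1])) =
      (if b = 0 then 0 else hook_sum a k (b - 1) (\<lambda>w. g (w @ [E1])))"
    by (simp add: hook_sum_def)
  also have "(\<Sum>xs\<in>linear_extensions (hook a k b - {(a + 1, k)}) ?R. g (map X_label xs @ [E0])) =
      hook_core a k b (\<lambda>w. g (w @ [E0]))"
    by (rule sum_hook_minus_top[OF k])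
  finally show ?thesis .
qed

lemma hook_sum_eq:
  assumes "k \<ge> 2"
  shows "hook_sum a k b g = (\<Sum>c\<le>b. hook_core a k c (\<lambda>w. g (w @ E0 # replicate (b - c) E1)))"
proof (induction b arbitrary: g)
  case 0
  then show ?case by (simp add: hook_sum_rec[OF assms])
next
  case (Suc b)
  have "hook_sum a k (Suc b) g = hook_core a k (Suc b) (\<lambda>w. g (w @ [E0])) +
      (\<Sum>c\<le>b. hook_core a k c (\<lambda>w. g ((w @ E0 # replicate (b - c) E1) @ [E1])))"
    using Suc by (subst hook_sum_rec[OF assms]) simp
  also have "(\<Sum>c\<le>b. hook_core a k c (\<lambda>w. g ((w @ E0 # replicate (b - c) E1) @ [E1]))) =
      (\<Sum>c\<le>b. hook_core a k c (\<lambda>w. g (w @ E0 # replicate (Suc b - c) E1)))"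
    by (intro sum.cong) (auto simp: Suc_diff_le replicate_append_same)
  finally show ?case by (simp add: add.commute)
qed

text \<open>The summand of index \<open>d\<close> collects the shuffles in which exactly \<open>d\<close> letters follow the last letter
  of the second word.\<close>

lemma sum_shuffle_e1s_snoc_e0:
  "(\<Sum>x\<in>#shuffle_words (replicate N E1) (u @ [E0]). g x) =
     (\<Sum>d\<le>N. \<Sum>w\<in>#shuffle_words (replicate (N - d) E1) u. g (w @ E0 # replicate d E1))"
proof (induction N arbitrary: g)
  case (Suc N)
  have rep: "replicate (Suc N) E1 = replicate N E1 @ [E1]" by (simp add: replicate_append_same)
  have "(\<Sum>x\<in>#shuffle_words (replicate (Suc N) E1) (u @ [E0]). g x) =
      (\<Sum>x\<in>#shuffle_words (replicate N E1) (u @ [E0]). g (x @ [E1])) +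
      (\<Sum>w\<in>#shuffle_words (replicate (Suc N) E1) u. g (w @ [E0]))"
    unfolding rep shuffle_words_snoc by (simp add: multiset.map_comp o_def)
  also have "(\<Sum>x\<in>#shuffle_words (replicate N E1) (u @ [E0]). g (x @ [E1])) =
      (\<Sum>d\<le>N. \<Sum>w\<in>#shuffle_words (replicate (Suc N - Suc d) E1) u. g (w @ E0 # replicate (Suc d) E1))"
    unfolding Suc[of "\<lambda>x. g (x @ [E1])"] by (simp add: replicate_append_same)
  finally show ?case by (subst sum.atMost_Suc_shift) (simp add: add.commute del: replicate_Suc)
qed simp

text \<open>With \<open>w(a, c, d)\<close> for the sum over the words \<open>(e\<^sub>1\<^sup>a sh e\<^sub>1 (e\<^sub>0\<^bsup>k-2\<^esup> sh e\<^sub>1\<^sup>c)) e\<^sub>0 e\<^sub>1\<^sup>d\<close>, both sides are the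
  sum of \<open>w(a, c, d)\<close> over all \<open>a + c + d = n\<close>.\<close>

lemma sum_hooks:
  assumes "k \<ge> 2"
  shows "(\<Sum>a\<le>n. hook_sum a k (n - a) g) =
    (\<Sum>c\<le>n. \<Sum>v\<in>#shuffle_words (replicate (k - 2) E0) (replicate c E1).
       \<Sum>x\<in>#shuffle_words (replicate (n - c) E1) (E1 # v @ [E0]). g x)"
proof -
  \<comment> \<open>Here \<open>F a c\<close> is \<open>w(a, c, n - a - c)\<close>.\<close>
  define F where "F a c = hook_core a k c (\<lambda>w. g (w @ E0 # replicate (n - a - c) E1))" for a c
  have "(\<Sum>a\<le>n. hook_sum a k (n - a) g) = (\<Sum>a\<le>n. \<Sum>c\<le>n - a. F a c)"
    by (simp add: hook_sum_eq[OF assms] F_def)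
  also have "\<dots> = (\<Sum>c\<le>n. \<Sum>a\<le>n - c. F a c)"
    unfolding sum.Sigma[OF finite_atMost ballI[OF finite_atMost]]
    by (rule sum.reindex_bij_witness[of _ prod.swap prod.swap]) auto
  also have "\<dots> = (\<Sum>c\<le>n. \<Sum>v\<in>#shuffle_words (replicate (k - 2) E0) (replicate c E1).
       \<Sum>x\<in>#shuffle_words (replicate (n - c) E1) (E1 # v @ [E0]). g x)"
  proof (intro sum.cong refl)
    fix c assume c: "c \<in> {..n}"
    have "(\<Sum>a\<le>n - c. F a c) = (\<Sum>d\<le>n - c. F (n - c - d) c)"
      by (rule sum.reindex_bij_witness[of _ "\<lambda>d. n - c - d" "\<lambda>d. n - c - d"])
         (auto simp del: diff_diff_left)
    also have "\<dots> = (\<Sum>d\<le>n - c. \<Sum>v\<in>#shuffle_words (replicate (k - 2) E0) (replicate c E1).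
        \<Sum>w\<in>#shuffle_words (replicate (n - c - d) E1) (E1 # v). g (w @ E0 # replicate d E1))"
      using c by (intro sum.cong) (auto simp: F_def hook_core_def)
    also have "\<dots> = (\<Sum>v\<in>#shuffle_words (replicate (k - 2) E0) (replicate c E1).
       \<Sum>x\<in>#shuffle_words (replicate (n - c) E1) (E1 # v @ [E0]). g x)"
    proof -
      have "(\<Sum>d\<le>n - c. \<Sum>w\<in>#shuffle_words (replicate (n - c - d) E1) (E1 # v). g (w @ E0 # replicate d E1)) =
          (\<Sum>x\<in>#shuffle_words (replicate (n - c) E1) (E1 # v @ [E0]). g x)" for v
        using sum_shuffle_e1s_snoc_e0[where N = "n - c" and u = "E1 # v" and g = g] by simp
      then show ?thesis by (simp only: flip: sum_mset_sum_swap)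
    qed
    finally show "(\<Sum>a\<le>n - c. F a c) = (\<Sum>v\<in>#shuffle_words (replicate (k - 2) E0) (replicate c E1).
       \<Sum>x\<in>#shuffle_words (replicate (n - c) E1) (E1 # v @ [E0]). g x)" .
  qed
  finally show ?thesis .
qed

section \<open>Double power series and a telescoping hypergeometric series\<close>

text \<open>Only positive arguments are used, so that the double series below have nonnegative terms.\<close>

lemma power_series_unique_right:
  fixes e :: "nat \<Rightarrow> real"
  assumes "\<delta> > 0" and "\<And>x. 0 < x \<Longrightarrow> x \<le> \<delta> \<Longrightarrow> ((\<lambda>p. e p * x ^ p) has_sum 0) UNIV"
  shows "e p = 0"
proof (induction p rule: less_induct)
  case (less p)
  have sums: "(\<lambda>j. e (j + p) * x ^ j) sums 0" if x: "0 < x" "x \<le> \<delta>" for x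
  proof -
    have "(\<lambda>j. e j * x ^ j) sums 0" using assms(2)[OF x] by (rule has_sum_imp_sums)
    moreover have "(\<Sum>j<p. e j * x ^ j) = 0" using less by simp
    ultimately have "(\<lambda>j. e (j + p) * x ^ (j + p)) sums 0"
      using sums_iff_shift[of "\<lambda>j. e j * x ^ j" p 0] by simp
    then have "(\<lambda>j. e (j + p) * x ^ (j + p) / x ^ p) sums (0 / x ^ p)"
      by (rule sums_divide)
    moreover have "e (j + p) * x ^ (j + p) / x ^ p = e (j + p) * x ^ j" for j
      using x by (simp add: power_add)
    ultimately show ?thesis by simp
  qed
  define f where "f x = suminf (\<lambda>j. e (j + p) * x ^ j)" for x
  have "(\<lambda>j. e (j + p) * x ^ j) sums f x" if "norm x < \<delta>" for x
  proof -
    have "summable (\<lambda>j. e (j + p) * \<delta> ^ j)"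
      using sums_summable[OF sums[of \<delta>]] assms(1) by blast
    then show ?thesis
      unfolding f_def using that assms(1) powser_inside[of "\<lambda>j. e (j + p)" \<delta> x] by (intro summable_sums) simp
  qed
  then have "(f \<longlongrightarrow> e (0 + p)) (at 0)"
    using assms(1) by (intro powser_limit_0[of \<delta>]) auto
  then have "(f \<longlongrightarrow> e p) (at_right 0)"
    by (simp add: filterlim_at_split)
  moreover have "eventually (\<lambda>x. x < \<delta>) (at_right 0)"
    using assms(1) by (intro eventually_at_rightI[of 0 \<delta>]) auto
  then have "eventually (\<lambda>x. f x = 0) (at_right 0)"
    using eventually_at_right_less[of 0]
    by eventually_elim (use sums in \<open>auto simp: f_def sums_iff\<close>)
  then have "(f \<longlongrightarrow> 0) (at_right 0)" by (rule tendsto_eventually)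
  ultimately show ?case by (intro tendsto_unique[of "at_right (0::real)"]) auto
qed

lemma double_power_series_unique:
  fixes a b :: "nat \<Rightarrow> nat \<Rightarrow> real"
  assumes "\<delta> > 0"
    and "\<And>x y. \<lbrakk>0 < x; x \<le> \<delta>; 0 < y; y \<le> \<delta>\<rbrakk> \<Longrightarrow> ((\<lambda>(p, q). a p q * x ^ p * y ^ q) has_sum S x y) UNIV"
    and "\<And>x y. \<lbrakk>0 < x; x \<le> \<delta>; 0 < y; y \<le> \<delta>\<rbrakk> \<Longrightarrow> ((\<lambda>(p, q). b p q * x ^ p * y ^ q) has_sum S x y) UNIV"
  shows "a p q = b p q"
proof -
  define d where "d p q = a p q - b p q" for p q
  define D where "D y p = infsum (\<lambda>q. d p q * y ^ q) UNIV" for y p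
  have sum: "((\<lambda>(p, q). d p q * x ^ p * y ^ q) has_sum 0) UNIV"
    if "0 < x" "x \<le> \<delta>" "0 < y" "y \<le> \<delta>" for x y
    using has_sum_add[OF assms(2)[OF that] has_sum_uminusI[OF assms(3)[OF that]]]
    by (simp add: d_def split_def algebra_simps)
  have inner: "((\<lambda>q. d p q * y ^ q) has_sum D y p) UNIV" if "0 < y" "y \<le> \<delta>" for y p
  proof -
    have "(\<lambda>(p, q). d p q * \<delta> ^ p * y ^ q) summable_on UNIV \<times> UNIV"
      using has_sum_imp_summable[OF sum[of \<delta> y]] that assms(1) by simp
    then have "(\<lambda>q. d p q * \<delta> ^ p * y ^ q) summable_on UNIV"
      by (rule summable_on_SigmaD1) auto
    then have "(\<lambda>q. inverse (\<delta> ^ p) * (d p q * \<delta> ^ p * y ^ q)) summable_on UNIV"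
      by (rule summable_on_cmult_right)
    then have "(\<lambda>q. d p q * y ^ q) summable_on UNIV"
      using assms(1) by (simp add: field_simps)
    then show ?thesis unfolding D_def by (rule has_sum_infsum)
  qed
  have "D y p = 0" if y: "0 < y" "y \<le> \<delta>" for y p
  proof (rule power_series_unique_right[OF assms(1)])
    fix x :: real assume x: "0 < x" "x \<le> \<delta>"
    have "((\<lambda>q. d p q * x ^ p * y ^ q) has_sum D y p * x ^ p) UNIV" for p
      using has_sum_cmult_right[OF inner[OF y, of p], of "x ^ p"] by (simp add: mult_ac)
    then show "((\<lambda>p. D y p * x ^ p) has_sum 0) UNIV"
      using has_sum_SigmaD[where A = UNIV and B = "\<lambda>_. UNIV" and f = "\<lambda>(p, q). d p q * x ^ p * y ^ q"]
        sum[OF x y] by simp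
  qed
  then have "d p q = 0"
    using inner by (intro power_series_unique_right[OF assms(1), of "d p"]) auto
  then show ?thesis by (simp add: d_def)
qed

text \<open>Tonelli's theorem for a series of families, with the outer sums given as convergent series.\<close>

lemma has_sum_swap_sums:
  fixes f :: "nat \<Rightarrow> 'a \<Rightarrow> real"
  assumes "\<And>n i. f n i \<ge> 0"
    and "\<And>n. (f n has_sum g n) UNIV" "g sums S" "\<And>i. (\<lambda>n. f n i) sums h i"
  shows "(h has_sum S) UNIV"
proof -
  have g: "(g has_sum S) UNIV"
    using assms(1-3) has_sum_nonneg by (intro sums_nonneg_imp_has_sum) blast+
  have "(\<lambda>(n, i). f n i) summable_on (UNIV \<times> UNIV)"
    using assms(1,2) by (intro summable_on_SigmaI[OF _ has_sum_imp_summable[OF g]]) auto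
  then have "((\<lambda>(n, i). f n i) has_sum S) (UNIV \<times> UNIV)"
    using assms(2) g by (intro has_sum_SigmaI) auto
  then have "((\<lambda>(i, n). f n i) has_sum S) (UNIV \<times> UNIV)"
    by (subst (asm) has_sum_swap) simp
  moreover have "((\<lambda>n. f n i) has_sum h i) UNIV" for i
    using assms(1,4) by (intro sums_nonneg_imp_has_sum) auto
  ultimately show ?thesis
    using has_sum_SigmaD[where A = UNIV and B = "\<lambda>_. UNIV" and f = "\<lambda>(i, n). f n i"] by simp
qed

text \<open>In rising factorials this is \<open>(1 - x + y)\<^sub>n / (N + 1 - x)\<^sub>n\<^sub>+\<^sub>1\<close>. The series of these terms divided by
  \<open>n + 1\<close> is, up to the factor \<open>y - x\<close>, the difference of the digamma function at \<open>N + 1 - x\<close> and at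
  \<open>N + 1 - y\<close>; raising \<open>N\<close> by 1 changes it by an elementary term.\<close>

fun hyp_term :: "real \<Rightarrow> real \<Rightarrow> nat \<Rightarrow> nat \<Rightarrow> real" where
  "hyp_term x y N 0 = 1 / (real N + 1 - x)"
| "hyp_term x y N (Suc n) =
     hyp_term x y N n * (real n + 1 - x + y) / (real N + real n + 2 - x)"

context
  fixes x y :: real
  assumes x: "0 < x" "x \<le> 1 / 4" and y: "0 < y" "y \<le> 1 / 4"
begin

lemma hyp_term_nonneg: "hyp_term x y N n \<ge> 0"
  using x y by (induction n) auto

lemma hyp_term_shift: "hyp_term x y N n * (real N + 1 - x) = hyp_term x y (Suc N) n * (real N + real n + 2 - x)"
proof (induction n)
  case 0
  then show ?case using x by simp
next
  case (Suc n)
  have nz: "real N + real n + 2 - x \<noteq> 0" "real N + real n + 3 - x \<noteq> 0" using x by auto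
  have "hyp_term x y N (Suc n) * (real N + 1 - x) =
      (hyp_term x y N n * (real N + 1 - x)) * (real n + 1 - x + y) / (real N + real n + 2 - x)"
    by simp
  also have "\<dots> = hyp_term x y (Suc N) n * (real n + 1 - x + y)"
    unfolding Suc using nz by simp
  also have "\<dots> = hyp_term x y (Suc N) (Suc n) * (real N + real (Suc n) + 2 - x)"
    using nz by (simp add: field_simps)
  finally show ?case .
qed

text \<open>The contiguous relation in the parameter \<open>N\<close>.\<close>

lemma hyp_term_diff:
  "hyp_term x y N n / real (Suc n) - hyp_term x y (Suc N) n / real (Suc n) = hyp_term x y (Suc N) n / (real N + 1 - x)"
proof -
  have nz: "real N + 1 - x > 0" using x by auto
  have "hyp_term x y N n = hyp_term x y (Suc N) n * (real N + real n + 2 - x) / (real N + 1 - x)"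
    using hyp_term_shift[of N n] nz by (simp add: field_simps)
  then have "hyp_term x y N n - hyp_term x y (Suc N) n = hyp_term x y (Suc N) n * real (Suc n) / (real N + 1 - x)"
    using nz by (simp add: field_simps)
  then show ?thesis by (simp flip: diff_divide_distrib)
qed

text \<open>The left side is the product of the factors \<open>(m - x + y) / (N + 1 + m - x)\<close> for \<open>1 \<le> m \<le> n\<close>, and
  \<open>y \<le> 1 / 4\<close> makes each of them at most the square root of \<open>m / (m + 1)\<close>.\<close>

lemma hyp_tail_bound: "hyp_term x y (Suc N) n * (real N + real n + 2 - x) \<le> 1 / sqrt (real n + 1)"
proof (induction n)
  case 0
  then show ?case using x by simp
next
  case (Suc n)
  define m where "m = real n + 1"
  have m: "m \<ge> 1" by (simp add: m_def)
  have "(m - x + y) / (real N + 1 + m - x) \<le> (m - x + y) / (1 + m - x)"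
    using m x y by (intro divide_left_mono) auto
  also have "\<dots> \<le> (m + 1 / 4) / (m + 1)"
  proof -
    have "(m - x + y) * (m + 1) \<le> (m - x + 1 / 4) * (m + 1)"
      using m y by (intro mult_right_mono) auto
    also have "\<dots> \<le> (m + 1 / 4) * (1 + m - x)"
    proof -
      have "(m + 1 / 4) * (1 + m - x) - (m - x + 1 / 4) * (m + 1) = 3 / 4 * x"
        by (simp add: field_simps)
      then show ?thesis using x by linarith
    qed
    finally show ?thesis using m x by (simp add: field_simps)
  qed
  also have "\<dots> \<le> sqrt (m / (m + 1))"
  proof (rule real_le_rsqrt)
    have "(m + 1 / 4)\<^sup>2 * (m + 1) \<le> m * (m + 1)\<^sup>2"
    proof -
      have "m * (m + 1)\<^sup>2 - (m + 1 / 4)\<^sup>2 * (m + 1) = m * m / 2 + 7 / 16 * m - 1 / 16"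
        by (simp add: power2_eq_square field_simps)
      moreover have "0 \<le> m * m" by simp
      ultimately show ?thesis using m by linarith
    qed
    then show "((m + 1 / 4) / (m + 1))\<^sup>2 \<le> m / (m + 1)"
      using m by (simp add: power_divide field_simps power2_eq_square)
  qed
  finally have le: "(m - x + y) / (real N + 1 + m - x) \<le> sqrt (m / (m + 1))" .
  have "hyp_term x y (Suc N) (Suc n) * (real N + real (Suc n) + 2 - x) =
      hyp_term x y (Suc N) n * (real N + real n + 2 - x) * ((m - x + y) / (real N + 1 + m - x))"
    using x by (simp add: m_def field_simps)
  also have "\<dots> \<le> 1 / sqrt m * sqrt (m / (m + 1))"
    using Suc le hyp_term_nonneg[of "Suc N" n] x y m
    by (intro mult_mono) (auto simp: m_def)
  also have "\<dots> = 1 / sqrt (real (Suc n) + 1)"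
    using m by (simp add: real_sqrt_divide m_def)
  finally show ?case .
qed

text \<open>The series telescopes, with the products of the preceding lemma as partial remainders.\<close>

lemma hyp_term_sums: "hyp_term x y (Suc N) sums (1 / (real N + 1 - y))"
proof -
  \<comment> \<open>By the recursion of the terms, \<open>s n - s (n + 1)\<close> is \<open>N + 1 - y\<close> times the \<open>n\<close>-th term.\<close>
  define s where "s n = hyp_term x y (Suc N) n * (real N + real n + 2 - x)" for n
  have "s \<longlonglongrightarrow> 0"
  proof (rule tendsto_sandwich)
    show "eventually (\<lambda>n. 0 \<le> s n) sequentially"
      unfolding s_def using x hyp_term_nonneg by (intro always_eventually allI mult_nonneg_nonneg) auto
    show "eventually (\<lambda>n. s n \<le> 1 / sqrt (real n + 1)) sequentially"
      unfolding s_def using hyp_tail_bound by simp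
    show "(\<lambda>n. 1 / sqrt (real n + 1)) \<longlonglongrightarrow> 0"
      by (intro real_tendsto_divide_at_top[OF tendsto_const] filterlim_compose[OF sqrt_at_top]
          filterlim_at_top_mono[OF filterlim_real_sequentially]) auto
  qed auto
  then have "(\<lambda>n. s n - s (Suc n)) sums (s 0 - 0)" by (rule telescope_sums')
  moreover have "s n - s (Suc n) = hyp_term x y (Suc N) n * (real N + 1 - y)" for n
    using x by (simp add: s_def field_simps)
  moreover have "s 0 = 1" using x by (simp add: s_def)
  ultimately have "(\<lambda>n. hyp_term x y (Suc N) n * (real N + 1 - y)) sums 1" by simp
  from sums_divide[OF this, of "real N + 1 - y"] show ?thesis using y by simp
qed

text \<open>Summed over \<open>n\<close>, the contiguous relation gives the difference of two consecutive values of \<open>N\<close> in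
  closed form; the sums tend to 0 for large \<open>N\<close>, so the value at \<open>N = 0\<close> telescopes.\<close>

lemma hyp_sum:
  "summable (\<lambda>n. hyp_term x y 0 n / real (Suc n))"
  "(\<lambda>N. 1 / ((real N + 1 - x) * (real N + 1 - y))) sums suminf (\<lambda>n. hyp_term x y 0 n / real (Suc n))"
proof -
  have div_le: "hyp_term x y N n / real (Suc n) \<le> hyp_term x y N n" for N n
    using divide_left_mono[of 1 "real (Suc n)" "hyp_term x y N n"] hyp_term_nonneg[of N n] by simp
  have summable_Suc: "summable (\<lambda>n. hyp_term x y (Suc N) n / real (Suc n))" for N
    using hyp_term_sums[of N] hyp_term_nonneg[of "Suc N"]
    by (intro summable_comparison_test'[OF sums_summable])
       (use div_le in auto)
  have split: "(\<lambda>n. hyp_term x y N n / real (Suc n)) =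
      (\<lambda>n. hyp_term x y (Suc N) n / real (Suc n) + hyp_term x y (Suc N) n / (real N + 1 - x))" for N
    using hyp_term_diff[of N] by (auto simp: fun_eq_iff algebra_simps)
  have div: "(\<lambda>n. hyp_term x y (Suc N) n / (real N + 1 - x)) sums (1 / (real N + 1 - y) / (real N + 1 - x))" for N
    by (intro sums_divide hyp_term_sums)
  define T where "T N = suminf (\<lambda>n. hyp_term x y N n / real (Suc n))" for N
  have summable: "summable (\<lambda>n. hyp_term x y N n / real (Suc n))" for N
    unfolding split[of N] using summable_Suc div by (intro summable_add sums_summable[OF div])
  then show "summable (\<lambda>n. hyp_term x y 0 n / real (Suc n))" .
  have step: "T N - T (Suc N) = 1 / ((real N + 1 - x) * (real N + 1 - y))" for N
  proof -
    have "(\<lambda>n. hyp_term x y N n / real (Suc n) - hyp_term x y (Suc N) n / real (Suc n)) sums (T N - T (Suc N))"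
      unfolding T_def by (intro sums_diff summable_sums summable)
    then show ?thesis
      unfolding hyp_term_diff using sums_unique2[OF _ div[of N]] by (simp add: mult.commute)
  qed
  have "(\<lambda>N. T (Suc N)) \<longlonglongrightarrow> 0"
  proof (rule tendsto_sandwich)
    show "eventually (\<lambda>N. 0 \<le> T (Suc N)) sequentially"
      unfolding T_def using summable hyp_term_nonneg
      by (intro always_eventually allI suminf_nonneg) auto
    have "T (Suc N) \<le> 1 / (real N + 1 - y)" for N
      unfolding T_def sums_unique[OF hyp_term_sums[of N]]
      by (intro suminf_le summable sums_summable[OF hyp_term_sums] div_le)
    then show "eventually (\<lambda>N. T (Suc N) \<le> 1 / (real N + 1 - y)) sequentially" by simp
    show "(\<lambda>N. 1 / (real N + 1 - y)) \<longlonglongrightarrow> 0"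
      using y by (intro real_tendsto_divide_at_top[OF tendsto_const]
          filterlim_at_top_mono[OF filterlim_real_sequentially] always_eventually) auto
  qed auto
  then have "T \<longlonglongrightarrow> 0" by (simp add: filterlim_sequentially_Suc)
  then have "(\<lambda>N. T N - T (Suc N)) sums (T 0 - 0)" by (rule telescope_sums')
  then show "(\<lambda>N. 1 / ((real N + 1 - x) * (real N + 1 - y))) sums suminf (\<lambda>n. hyp_term x y 0 n / real (Suc n))"
    unfolding step by (simp add: T_def)
qed

end

section \<open>The sum formula\<close>

abbreviation e0_e1_shuffles :: "nat \<Rightarrow> nat \<Rightarrow> letter list multiset" where
  "e0_e1_shuffles p q \<equiv> shuffle_words (replicate p E0) (replicate q E1)"

lemma e0_e1_shuffles_Suc:
  "e0_e1_shuffles (Suc p) (Suc q) =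
     image_mset (\<lambda>w. w @ [E0]) (e0_e1_shuffles p (Suc q)) +
     image_mset (\<lambda>w. w @ [E1]) (e0_e1_shuffles (Suc p) q)"
  "e0_e1_shuffles (Suc p) 0 = image_mset (\<lambda>w. w @ [E0]) (e0_e1_shuffles p 0)"
  "e0_e1_shuffles 0 (Suc q) = image_mset (\<lambda>w. w @ [E1]) (e0_e1_shuffles 0 q)"
  using shuffle_words_snoc[of "replicate p E0" E0 "replicate q E1" E1]
  by (simp_all add: replicate_append_same)

text \<open>The words \<open>v\<close> are all words with \<open>p\<close> letters \<^term>\<open>E0\<close> and \<open>q\<close> letters \<^term>\<open>E1\<close>, each taken once.\<close>

definition shuffle_coeff :: "nat \<Rightarrow> nat \<Rightarrow> nat \<Rightarrow> real" where
  "shuffle_coeff p q n = (\<Sum>v\<in>#e0_e1_shuffles p q. fps_nth (polylog (E1 # v)) n)"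

lemma shuffle_coeff_rec:
  "real n * shuffle_coeff p q n =
     (if p = 0 then 0 else shuffle_coeff (p - 1) q n) +
     (if q = 0 then 0 else \<Sum>m<n. shuffle_coeff p (q - 1) m) +
     (if p = 0 \<and> q = 0 \<and> n > 0 then 1 else 0)"
proof -
  have "real n * fps_nth (polylog (E1 # v @ [E0])) n = fps_nth (polylog (E1 # v)) n" for v
    using polylog_snoc_E0_nth[of "E1 # v" n] polylog_nth_0[of "E1 # v"] by (cases "n = 0") simp_all
  then have E0: "real n * (\<Sum>v\<in>#image_mset (\<lambda>w. w @ [E0]) M. fps_nth (polylog (E1 # v)) n) =
      (\<Sum>v\<in>#M. fps_nth (polylog (E1 # v)) n)" for M
    by (simp add: multiset.map_comp o_def sum_mset_distrib_left)
  have "real n * fps_nth (polylog (E1 # v @ [E1])) n = (\<Sum>m<n. fps_nth (polylog (E1 # v)) m)" for v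
    using polylog_snoc_E1_nth[of "E1 # v" n] by (cases "n = 0") simp_all
  then have E1: "real n * (\<Sum>v\<in>#image_mset (\<lambda>w. w @ [E1]) M. fps_nth (polylog (E1 # v)) n) =
      (\<Sum>m<n. \<Sum>v\<in>#M. fps_nth (polylog (E1 # v)) m)" for M
    by (simp add: multiset.map_comp o_def sum_mset_distrib_left sum_mset_sum_swap)
  have E: "real n * fps_nth (polylog [E1]) n = (if n > 0 then 1 else 0)"
    using polylog_snoc_E1_nth[of "[]" n] by (cases "n = 0") (simp_all add: sum.delta)
  consider "p = 0" "q = 0" | p' where "p = Suc p'" "q = 0" | q' where "p = 0" "q = Suc q'"
    | p' q' where "p = Suc p'" "q = Suc q'"
    by (cases p; cases q) auto
  then show ?thesis
  proof cases
    case 1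
    then show ?thesis by (simp add: shuffle_coeff_def E)
  next
    case 2
    show ?thesis
      unfolding 2 shuffle_coeff_def e0_e1_shuffles_Suc E0 by simp
  next
    case 3
    show ?thesis
      unfolding 3 shuffle_coeff_def e0_e1_shuffles_Suc E1 by simp
  next
    case 4
    show ?thesis
      unfolding 4 shuffle_coeff_def e0_e1_shuffles_Suc image_mset_union sum_mset.union
        distrib_left E0 E1 by simp
  qed
qed

lemma sum_mset_nonneg: "(\<And>v. v \<in># M \<Longrightarrow> f v \<ge> 0) \<Longrightarrow> (\<Sum>v\<in>#M. f v) \<ge> (0 :: real)"
  by (induction M) auto

lemma shuffle_coeff_nonneg: "shuffle_coeff p q n \<ge> 0"
  unfolding shuffle_coeff_def by (intro sum_mset_nonneg) auto

lemma shuffle_coeff_le: "shuffle_coeff p q n \<le> 2 ^ (p + q)"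
proof (induction "p + q" arbitrary: p q n rule: less_induct)
  case less
  show ?case
  proof (cases "n = 0")
    case True
    have "shuffle_coeff p q 0 = 0"
      unfolding shuffle_coeff_def by (intro sum_mset.neutral) (auto simp: polylog_nth_0)
    then show ?thesis using True by simp
  next
    case False
    have one: "1 \<le> real n" using False by simp
    define s where "s = (2 :: real) ^ (p + q - 1)"
    have s: "s \<ge> 1" by (simp add: s_def)
    have 1: "(if p = 0 then 0 else shuffle_coeff (p - 1) q n) \<le> (if p = 0 then 0 else s)"
      using less[of "p - 1" q n] by (auto simp: s_def)
    have 2: "(if q = 0 then 0 else \<Sum>m<n. shuffle_coeff p (q - 1) m) \<le> (if q = 0 then 0 else real n * s)"
    proof (cases "q = 0")
      case False
      then have "(\<Sum>m<n. shuffle_coeff p (q - 1) m) \<le> (\<Sum>m<n. s)"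
        using less[of p "q - 1"] by (intro sum_mono) (auto simp: s_def)
      then show ?thesis using False by simp
    qed simp
    have ns: "s \<le> real n * s" using one s by simp
    have "real n * shuffle_coeff p q n \<le> real n * 2 ^ (p + q)"
    proof (cases "p + q = 0")
      case True
      then show ?thesis using shuffle_coeff_rec[of n p q] one by simp
    next
      case False
      then have "2 ^ (p + q) = 2 * s" unfolding s_def by (cases "p + q") auto
      moreover have "real n * shuffle_coeff p q n \<le> s + real n * s"
      proof -
        have "(if p = 0 then 0 else shuffle_coeff (p - 1) q n) \<le> s"
          using 1 s by (simp split: if_splits)
        moreover have "(if q = 0 then 0 else \<Sum>m<n. shuffle_coeff p (q - 1) m) \<le> real n * s"
          using 2 ns s by (simp split: if_splits)
        ultimately show ?thesis
          using shuffle_coeff_rec[of n p q] False by auto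
      qed
      ultimately show ?thesis using ns by simp
    qed
    then show ?thesis using one by simp
  qed
qed

lemma has_sum_geometric2:
  fixes a b :: real
  assumes "0 \<le> a" "a < 1" "0 \<le> b" "b < 1"
  shows "((\<lambda>(p, q). a ^ p * b ^ q) has_sum (1 / ((1 - a) * (1 - b)))) UNIV"
proof -
  have geo: "((\<lambda>p. c ^ p) has_sum (1 / (1 - c))) UNIV" if "0 \<le> c" "c < 1" for c :: real
    using that by (intro sums_nonneg_imp_has_sum geometric_sums) auto
  have inner: "((\<lambda>q. a ^ p * b ^ q) has_sum (a ^ p * (1 / (1 - b)))) UNIV" for p
    using assms by (intro has_sum_cmult_right geo) auto
  have outer: "((\<lambda>p. a ^ p * (1 / (1 - b))) has_sum (1 / (1 - a) * (1 / (1 - b)))) UNIV"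
    using assms by (intro has_sum_cmult_left geo) auto
  have "(\<lambda>(p, q). a ^ p * b ^ q) summable_on UNIV \<times> UNIV"
    using inner assms by (intro summable_on_SigmaI[OF _ has_sum_imp_summable[OF outer]]) auto
  then have "((\<lambda>(p, q). a ^ p * b ^ q) has_sum (1 / (1 - a) * (1 / (1 - b)))) (UNIV \<times> UNIV)"
    using inner outer by (intro has_sum_SigmaI) auto
  then show ?thesis by simp
qed

lemma has_sum_inj_extend:
  assumes "(f has_sum (S :: real)) UNIV" "\<And>x. k (h x) = x" "\<And>y. P y \<longleftrightarrow> y \<in> range h"
  shows "((\<lambda>y. if P y then f (k y) else 0) has_sum S) UNIV"
proof -
  let ?g = "\<lambda>y. if P y then f (k y) else 0"
  have "?g \<circ> h = f" using assms(2,3) by auto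
  moreover have "inj h" using assms(2) by (metis injI)
  ultimately have "(?g has_sum S) (range h)" using assms(1) has_sum_reindex[of h UNIV ?g S] by simp
  also have "(?g has_sum S) (range h) \<longleftrightarrow> (?g has_sum S) UNIV"
    by (rule has_sum_cong_neutral) (use assms(3) in auto)
  finally show ?thesis .
qed

lemma has_sum_shift:
  assumes "(f has_sum (S :: real)) (UNIV :: (nat \<times> nat) set)"
  shows "((\<lambda>(p, q). if p = 0 then 0 else f (p - 1, q)) has_sum S) UNIV"
    and "((\<lambda>(p, q). if q = 0 then 0 else f (p, q - 1)) has_sum S) UNIV"
proof -
  have "y \<in> range (map_prod Suc id)" if "fst y \<noteq> 0" for y :: "nat \<times> nat"
    by (rule image_eqI[of _ _ "map_prod (\<lambda>p. p - 1) id y"]) (use that in \<open>simp_all add: prod_eq_iff\<close>)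
  then have "((\<lambda>y. if fst y \<noteq> 0 then f (map_prod (\<lambda>p. p - 1) id y) else 0) has_sum S) UNIV"
    by (intro has_sum_inj_extend[OF assms, where h = "map_prod Suc id"]) (auto simp: prod_eq_iff)
  also have "(\<lambda>y. if fst y \<noteq> 0 then f (map_prod (\<lambda>p. p - 1) id y) else 0) =
      (\<lambda>(p, q). if p = 0 then 0 else f (p - 1, q))"
    by (simp add: fun_eq_iff)
  finally show "((\<lambda>(p, q). if p = 0 then 0 else f (p - 1, q)) has_sum S) UNIV" .
  have "y \<in> range (map_prod id Suc)" if "snd y \<noteq> 0" for y :: "nat \<times> nat"
    by (rule image_eqI[of _ _ "map_prod id (\<lambda>p. p - 1) y"]) (use that in \<open>simp_all add: prod_eq_iff\<close>)
  then have "((\<lambda>y. if snd y \<noteq> 0 then f (map_prod id (\<lambda>p. p - 1) y) else 0) has_sum S) UNIV"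
    by (intro has_sum_inj_extend[OF assms, where h = "map_prod id Suc"]) (auto simp: prod_eq_iff)
  also have "(\<lambda>y. if snd y \<noteq> 0 then f (map_prod id (\<lambda>p. p - 1) y) else 0) =
      (\<lambda>(p, q). if q = 0 then 0 else f (p, q - 1))"
    by (simp add: fun_eq_iff)
  finally show "((\<lambda>(p, q). if q = 0 then 0 else f (p, q - 1)) has_sum S) UNIV" .
qed

lemma has_sum_sum_lessThan:
  assumes "\<And>m. (f m has_sum (g m :: real)) A"
  shows "((\<lambda>i. \<Sum>m<(n::nat). f m i) has_sum (\<Sum>m<n. g m)) A"
  by (induction n) (auto intro!: has_sum_add assms)

text \<open>The generating function \<open>G\<close> in \<open>z\<close> of the left sides satisfies
  \<open>G' = (x / z + y / (1 - z)) G + 1 / (1 - z)\<close>. Its coefficients then obey a two-term recurrence,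
  whose solution is a quotient of rising factorials.\<close>

lemma shuffle_coeff_gen_fun:
  assumes x: "0 < x" "x \<le> 1 / 4" and y: "0 < y" "y \<le> 1 / 4"
  shows "((\<lambda>(p, q). shuffle_coeff p q (Suc n) * x ^ p * y ^ q) has_sum hyp_term x y 0 n) UNIV"
proof -
  define h where "h n = (\<lambda>(p, q). shuffle_coeff p q n * x ^ p * y ^ q)" for n
  define G where "G n = infsum (h n) UNIV" for n
  have h: "(h n has_sum G n) UNIV" for n
    unfolding G_def
  proof (rule has_sum_infsum, rule summable_on_comparison_test)
    show "(\<lambda>(p, q). (2 * x) ^ p * (2 * y) ^ q) summable_on UNIV"
      by (rule has_sum_imp_summable[OF has_sum_geometric2]) (use x y in simp_all)
    fix pq :: "nat \<times> nat"
    obtain p q where pq: "pq = (p, q)" by (cases pq)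
    show "h n pq \<ge> 0"
      using x y shuffle_coeff_nonneg by (simp add: h_def pq)
    have "shuffle_coeff p q n * (x ^ p * y ^ q) \<le> 2 ^ (p + q) * (x ^ p * y ^ q)"
      using x y shuffle_coeff_le by (intro mult_right_mono) auto
    then show "h n pq \<le> (case pq of (p, q) \<Rightarrow> (2 * x) ^ p * (2 * y) ^ q)"
      by (simp add: h_def pq power_add power_mult_distrib mult_ac)
  qed
  have rec: "real n * G n = x * G n + y * (\<Sum>m<n. G m) + (if n > 0 then 1 else 0)" for n
  proof -
    define e where "e = (\<lambda>(p :: nat, q :: nat). if p = 0 \<and> q = 0 \<and> n > 0 then 1 else 0 :: real)"
    have e: "(e has_sum (if n > 0 then 1 else 0)) UNIV"
      by (rule has_sum_finite_neutralI[of "{(0, 0)}"]) (auto simp: e_def split: if_splits)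
    have "((\<lambda>pq. x * (case pq of (p, q) \<Rightarrow> if p = 0 then 0 else h n (p - 1, q)) +
        y * (case pq of (p, q) \<Rightarrow> if q = 0 then 0 else \<Sum>m<n. h m (p, q - 1)) + e pq)
        has_sum (x * G n + y * (\<Sum>m<n. G m) + (if n > 0 then 1 else 0))) UNIV"
      by (intro has_sum_add has_sum_cmult_right has_sum_shift(1) h e
          has_sum_shift(2)[OF has_sum_sum_lessThan[OF h]])
    also have "(\<lambda>pq. x * (case pq of (p, q) \<Rightarrow> if p = 0 then 0 else h n (p - 1, q)) +
        y * (case pq of (p, q) \<Rightarrow> if q = 0 then 0 else \<Sum>m<n. h m (p, q - 1)) + e pq) =
        (\<lambda>pq. real n * h n pq)"
    proof
      fix pq :: "nat \<times> nat"
      obtain p q where pq: "pq = (p, q)" by (cases pq)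
      have "real n * h n pq = (real n * shuffle_coeff p q n) * x ^ p * y ^ q"
        by (simp add: h_def pq)
      also have "\<dots> = x * (if p = 0 then 0 else h n (p - 1, q)) +
        y * (if q = 0 then 0 else \<Sum>m<n. h m (p, q - 1)) + e pq"
        unfolding shuffle_coeff_rec
        by (cases p; cases q)
           (simp_all add: h_def pq e_def sum_distrib_left sum_distrib_right algebra_simps)
      finally show "x * (case pq of (p, q) \<Rightarrow> if p = 0 then 0 else h n (p - 1, q)) +
        y * (case pq of (p, q) \<Rightarrow> if q = 0 then 0 else \<Sum>m<n. h m (p, q - 1)) + e pq =
        real n * h n pq" by (simp add: pq)
    qed
    finally have "((\<lambda>pq. real n * h n pq) has_sum
        (x * G n + y * (\<Sum>m<n. G m) + (if n > 0 then 1 else 0))) UNIV" .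
    moreover have "((\<lambda>pq. real n * h n pq) has_sum (real n * G n)) UNIV"
      by (intro has_sum_cmult_right h)
    ultimately show ?thesis using has_sum_unique by blast
  qed
  have G0: "G 0 = 0" using rec[of 0] x by simp
  have "G (Suc n) = hyp_term x y 0 n" for n
  proof (induction n)
    case 0
    have "(1 - x) * G 1 = 1" using rec[of 1] G0 by (simp add: algebra_simps)
    then show ?case using x by (simp add: field_simps)
  next
    case (Suc n)
    have "(real n + 2 - x) * G (Suc (Suc n)) = G (Suc n) * (real n + 1 - x + y)"
      using rec[of "Suc n"] rec[of "Suc (Suc n)"] by (simp add: algebra_simps)
    moreover have "real n + 2 - x \<noteq> 0" using x by auto
    ultimately have "G (Suc (Suc n)) = G (Suc n) * (real n + 1 - x + y) / (real n + 2 - x)"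
      by (simp add: field_simps)
    then show ?case using Suc by simp
  qed
  then show ?thesis using h[of "Suc n"] by (simp add: h_def)
qed

text \<open>Weighted by \<open>x\<^sup>p y\<^sup>q\<close> and summed over \<open>p\<close> and \<open>q\<close>, the left sides give the hypergeometric series and
  the right sides give \<open>\<Sum>N. 1 / ((N + 1 - x) (N + 1 - y))\<close>, expanded into geometric series. The two
  functions agree, hence so do the coefficients.\<close>

lemma sum_formula:
  "(\<Sum>v\<in>#e0_e1_shuffles p q. suminf (fps_nth (polylog (E1 # v @ [E0])))) =
     suminf (\<lambda>N. 1 / (real N + 1) ^ (p + q + 2))"
proof -
  define Z where "Z p q = (\<Sum>v\<in>#e0_e1_shuffles p q. suminf (fps_nth (polylog (E1 # v @ [E0]))))"
    for p q
  define \<zeta> where "\<zeta> p q = suminf (\<lambda>N. 1 / (real N + 1) ^ (p + q + 2))" for p q :: nat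
  define S where "S x y = suminf (\<lambda>n. hyp_term x y 0 n / real (Suc n))" for x y
  have Z: "(\<lambda>n. shuffle_coeff p q (Suc n) / real (Suc n)) sums Z p q" for p q
  proof -
    have "(\<lambda>n. \<Sum>v\<in>#e0_e1_shuffles p q. fps_nth (polylog (E1 # v @ [E0])) n) sums Z p q"
      unfolding Z_def by (intro sums_sum_mset summable_sums admissible_summable) auto
    moreover have "(\<Sum>v\<in>#e0_e1_shuffles p q. fps_nth (polylog (E1 # v @ [E0])) n) =
        shuffle_coeff p q n / real n" for n
      using polylog_snoc_E0_nth[of "E1 # _" n]
      by (simp add: shuffle_coeff_def divide_inverse sum_mset_distrib_right)
    ultimately have "(\<lambda>n. shuffle_coeff p q n / real n) sums Z p q" by simp
    then show ?thesis
      using sums_Suc_iff[of "\<lambda>n. shuffle_coeff p q n / real n" "Z p q"] by simp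
  qed
  have \<zeta>: "(\<lambda>N. 1 / (real N + 1) ^ (p + q + 2)) sums \<zeta> p q" for p q
  proof -
    have "summable (\<lambda>N. inverse (real (Suc N) ^ (p + q + 2)))"
      by (subst summable_Suc_iff) (intro inverse_power_summable, simp)
    then show ?thesis
      unfolding \<zeta>_def by (intro summable_sums) (simp add: inverse_eq_divide add.commute)
  qed
  \<comment> \<open>On \<open>(0, 1 / 4]\<close> the coefficients, of size at most \<open>2\<^bsup>p+q\<^esup>\<close>, give a convergent double series, and the
    remainder estimate for the hypergeometric terms applies.\<close>
  have "Z p q = \<zeta> p q"
  proof (rule double_power_series_unique[where \<delta> = "1 / 4" and S = S])
    fix x y :: real
    assume xy: "0 < x" "x \<le> 1 / 4" "0 < y" "y \<le> 1 / 4"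
    show "((\<lambda>(p, q). Z p q * x ^ p * y ^ q) has_sum S x y) UNIV"
    proof (rule has_sum_swap_sums)
      show "(\<lambda>n. hyp_term x y 0 n / real (Suc n)) sums S x y"
        unfolding S_def by (intro summable_sums hyp_sum(1) xy)
      show "((\<lambda>(p, q). shuffle_coeff p q (Suc n) / real (Suc n) * x ^ p * y ^ q) has_sum
          hyp_term x y 0 n / real (Suc n)) UNIV" for n
        using has_sum_cmult_left[OF shuffle_coeff_gen_fun[OF xy, of n], of "1 / real (Suc n)"]
        by (simp add: split_def)
      show "(case i of (p, q) \<Rightarrow> shuffle_coeff p q (Suc n) / real (Suc n) * x ^ p * y ^ q) \<ge> 0" for n i
        using xy shuffle_coeff_nonneg by (auto simp: split_def)
      show "(\<lambda>n. case i of (p, q) \<Rightarrow> shuffle_coeff p q (Suc n) / real (Suc n) * x ^ p * y ^ q) sums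
          (case i of (p, q) \<Rightarrow> Z p q * x ^ p * y ^ q)" for i
        unfolding split_def by (intro sums_mult2 Z)
    qed
    show "((\<lambda>(p, q). \<zeta> p q * x ^ p * y ^ q) has_sum S x y) UNIV"
    proof (rule has_sum_swap_sums)
      show "(\<lambda>N. 1 / ((real N + 1 - x) * (real N + 1 - y))) sums S x y"
        unfolding S_def by (intro hyp_sum(2) xy)
      show "((\<lambda>(p, q). 1 / (real N + 1) ^ (p + q + 2) * x ^ p * y ^ q) has_sum
          (1 / ((real N + 1 - x) * (real N + 1 - y)))) UNIV" for N
      proof -
        define M where "M = real N + 1"
        have M: "M \<ge> 1" by (simp add: M_def)
        have "((\<lambda>i. (case i of (p, q) \<Rightarrow> (x / M) ^ p * (y / M) ^ q) * (1 / M\<^sup>2)) has_sum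
            (1 / ((1 - x / M) * (1 - y / M)) * (1 / M\<^sup>2))) UNIV"
          using xy M by (intro has_sum_cmult_left has_sum_geometric2) auto
        also have "1 / ((1 - x / M) * (1 - y / M)) * (1 / M\<^sup>2) = 1 / ((M - x) * (M - y))"
        proof -
          have "(1 - x / M) * (1 - y / M) * M\<^sup>2 = (M - x) * (M - y)"
            using M by (simp add: field_simps power2_eq_square)
          then show ?thesis by simp
        qed
        also have "(\<lambda>i. (case i of (p, q) \<Rightarrow> (x / M) ^ p * (y / M) ^ q) * (1 / M\<^sup>2)) =
            (\<lambda>(p, q). 1 / M ^ (p + q + 2) * x ^ p * y ^ q)"
          by (auto simp: fun_eq_iff power_add power_divide power2_eq_square)
        finally show ?thesis by (simp add: M_def)
      qed
      show "(case i of (p, q) \<Rightarrow> 1 / (real N + 1) ^ (p + q + 2) * x ^ p * y ^ q) \<ge> 0" for N i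
        using xy by (auto simp: split_def)
      show "(\<lambda>N. case i of (p, q) \<Rightarrow> 1 / (real N + 1) ^ (p + q + 2) * x ^ p * y ^ q) sums
          (case i of (p, q) \<Rightarrow> \<zeta> p q * x ^ p * y ^ q)" for i
        unfolding split_def by (intro sums_mult2 \<zeta>)
    qed
  qed auto
  then show ?thesis by (simp add: Z_def \<zeta>_def)
qed

lemma mzv_singleton:
  assumes "k \<ge> 2"
  shows "mzv [k] = suminf (\<lambda>N. 1 / (real N + 1) ^ k)"
proof -
  let ?w = "index_word [k]"
  have w: "?w = [E1] @ replicate (k - 1) E0" by (simp add: index_word_def)
  have nth: "fps_nth (polylog ?w) n = (if n = 0 then 0 else 1 / real n ^ k)" for n
  proof (cases "n = 0")
    case False
    have "fps_nth (polylog [E1]) n = 1 / real n"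
      using polylog_snoc_E1_nth[of "[]" n] False by (simp add: sum.delta)
    then show ?thesis
      using False assms unfolding w polylog_append_E0s_nth by (cases k) auto
  qed (auto simp: polylog_nth_0 w)
  have "last ?w = E0" using assms by (simp add: w)
  then have "summable (fps_nth (polylog ?w))"
    by (intro admissible_summable e1_word_index_word) auto
  then have "suminf (fps_nth (polylog ?w)) = suminf (\<lambda>n. fps_nth (polylog ?w) (Suc n))"
    by (subst suminf_split_head) (simp_all add: nth)
  also have "\<dots> = suminf (\<lambda>N. 1 / (real N + 1) ^ k)"
    by (simp add: nth add.commute)
  finally show ?thesis
    using assms by (subst mzv_eq_suminf_polylog) auto
qed

section \<open>Evaluation of the star sum\<close>

text \<open>An element labelled \<^term>\<open>E0\<close> has the element below it in its column as a predecessor, so it cannot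
  come first.\<close>

lemma hook_linear_extension_e1_word:
  assumes k: "k \<ge> 2" and xs: "xs \<in> linear_extensions (hook a k b) (hook_rel a k)"
  shows "e1_word (map X_label xs)"
proof (cases xs)
  case (Cons x xs')
  obtain i j where ij: "x = (i, j)" by (cases x)
  have x: "x \<in> hook a k b" using linear_extensionsD(2)[OF xs] Cons by auto
  have sorted: "sorted_wrt (\<lambda>x y. (y, x) \<notin> hook_rel a k) xs"
    using xs unfolding linear_extensions_iff[OF irrefl_hook_rel] by simp
  have "j = 1"
  proof (rule ccontr)
    assume "j \<noteq> 1"
    then have *: "(i, j - 1) \<in> hook a k b" "((i, j - 1), x) \<in> hook_rel a k"
      using x k by (auto simp: ij hook_iff hook_rel_iff)
    have "(i, j - 1) \<noteq> x" using *(2) irrefl_hook_rel by (auto simp: irrefl_def)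
    then have "(i, j - 1) \<in> set xs'" using *(1) linear_extensionsD(2)[OF xs] Cons by auto
    then show False using sorted *(2) Cons by simp
  qed
  then show ?thesis by (simp add: Cons ij X_label_def)
qed simp

lemma zeta_star_sh_hook:
  assumes "k \<ge> 2"
  shows "zeta_star_sh (replicate a 1 @ [k] @ replicate b 1) = hook_sum a k b reg"
proof -
  let ?ks = "replicate a 1 @ [k] @ replicate b 1"
  let ?L = "linear_extensions (hook a k b) (hook_rel a k)"
  have w: "w_poset ?ks = (\<Sum>xs\<in>?L. of_word (map X_label xs))"
    using linear_extensions_hook[OF assms, of a b] by (simp add: w_poset_def hook_def)
  have "w_poset ?ks \<in> h1"
    unfolding w using hook_linear_extension_e1_word[OF assms] by (intro h1_sum) simp
  then have "zeta_star_sh ?ks = reg_poly (w_poset ?ks)"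
    by (simp add: zeta_star_sh_def Z_sh_eq_reg_poly)
  also have "\<dots> = hook_sum a k b reg"
    unfolding w by (simp add: reg_poly_sum reg_poly_single hook_sum_def)
  finally show ?thesis .
qed

lemma sum_reg_admissible_shuffles:
  "(\<Sum>v\<in>#e0_e1_shuffles p q. reg (E1 # v @ [E0])) = [:mzv [p + q + 2]:]"
proof -
  have "(\<Sum>v\<in>#e0_e1_shuffles p q. reg (E1 # v @ [E0])) =
      (\<Sum>v\<in>#e0_e1_shuffles p q. [:suminf (fps_nth (polylog (E1 # v @ [E0]))):])"
    by (simp add: reg_admissible)
  also have "(\<Sum>v\<in>#M. [:c v:]) = [:\<Sum>v\<in>#M. c v:]" for M and c :: "letter list \<Rightarrow> real"
    by (induction M) auto
  finally show ?thesis by (simp add: sum_formula mzv_singleton)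
qed

theorem corollary1p3:
  fixes k r :: nat
  assumes "k \<ge> 2" and "r \<ge> 1"
  shows "(\<Sum>i=0..r-1. zeta_star_sh (replicate i 1 @ [k] @ replicate (r - 1 - i) 1)) =
         (\<Sum>j=0..r-1. monom (mzv [k + r - 1 - j] / fact j) j)"
proof -
  define n where "n = r - 1"
  have "(\<Sum>i=0..r-1. zeta_star_sh (replicate i 1 @ [k] @ replicate (r - 1 - i) 1)) =
      (\<Sum>a\<le>n. hook_sum a k (n - a) reg)"
    unfolding n_def atLeast0AtMost by (intro sum.cong refl zeta_star_sh_hook assms(1))
  also have "\<dots> = (\<Sum>c\<le>n. \<Sum>v\<in>#e0_e1_shuffles (k - 2) c.
       \<Sum>x\<in>#shuffle_words (replicate (n - c) E1) (E1 # v @ [E0]). reg x)"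
    by (rule sum_hooks[OF assms(1)])
  also have "\<dots> = (\<Sum>c\<le>n. monom (mzv [k + c] / fact (n - c)) (n - c))"
  proof (intro sum.cong refl)
    fix c
    have "(\<Sum>v\<in>#e0_e1_shuffles (k - 2) c.
        \<Sum>x\<in>#shuffle_words (replicate (n - c) E1) (E1 # v @ [E0]). reg x) =
        (\<Sum>v\<in>#e0_e1_shuffles (k - 2) c. reg (replicate (n - c) E1) * reg (E1 # v @ [E0]))"
    proof -
      have "reg (replicate (n - c) E1) * reg (E1 # v @ [E0]) =
          (\<Sum>x\<in>#shuffle_words (replicate (n - c) E1) (E1 # v @ [E0]). reg x)" for v
        by (rule reg_shuffle) (cases "n - c", auto)
      then show ?thesis by simp
    qed
    also have "\<dots> = reg (replicate (n - c) E1) * [:mzv [k - 2 + c + 2]:]"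
      by (simp only: sum_reg_admissible_shuffles flip: sum_mset_distrib_left)
    also have "\<dots> = monom (mzv [k + c] / fact (n - c)) (n - c)"
    proof -
      have "k - 2 + c + 2 = k + c" using assms(1) by simp
      then show ?thesis by (simp only: reg_replicate_E1) (simp add: smult_monom mult.commute)
    qed
    finally show "(\<Sum>v\<in>#e0_e1_shuffles (k - 2) c.
        \<Sum>x\<in>#shuffle_words (replicate (n - c) E1) (E1 # v @ [E0]). reg x) =
        monom (mzv [k + c] / fact (n - c)) (n - c)" .
  qed
  also have "\<dots> = (\<Sum>j\<le>n. monom (mzv [k + (n - j)] / fact j) j)"
    by (rule sum.reindex_bij_witness[of _ "\<lambda>j. n - j" "\<lambda>c. n - c"]) auto
  also have "\<dots> = (\<Sum>j=0..r-1. monom (mzv [k + r - 1 - j] / fact j) j)"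
    unfolding atLeast0AtMost n_def[symmetric]
    using assms(2) by (intro sum.cong refl) (auto simp: n_def)
  finally show ?thesis .
qed

end
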